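(* $\alpha(n,2) = O\!\left(n/\sqrt{\log^* n}\right)$; that is, there is a constant $C>0$ such that $\alpha(n,2) \le C\, n/\sqrt{\log^* n}$ for all sufficiently large $n$.
   Context: A finite set of points in $\mathbb{R}^d$ is in general position if no hyperplane contains more than $d$ of its points. For a finite set $P\subset\mathbb{R}^d$ in which at most $d+1$ points lie on any hyperplane, $\alpha(P)$ denotes the maximum size of a subset of $P$ in general position, and $\alpha(n,d)=\min\{\alpha(P): P\subset\mathbb{R}^d,\ |P|=n,\ \text{at most } d+1 \text{ points of } P \text{ on any hyperplane}\}$. Thus $\alpha(n,2)$ is the minimum, over $n$-point sets in the plane with no four points on a line, of the largest subset with no three collinear points. $\log^*$ denotes the iterated logarithm. *)

theory Defs
  imports "HOL-Analysis.Analysis"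
begin

definition hyperplane :: "'a::euclidean_space set \<Rightarrow> bool" where
  "hyperplane H \<longleftrightarrow> (\<exists>a b. a \<noteq> 0 \<and> H = {x. a \<bullet> x = b})"

definition general_position :: "'a::euclidean_space set \<Rightarrow> bool" where
  "general_position S \<longleftrightarrow>
     finite S \<and> (\<forall>H. hyperplane H \<longrightarrow> card (S \<inter> H) \<le> DIM('a))"

definition almost_general_position :: "'a::euclidean_space set \<Rightarrow> bool" where
  "almost_general_position P \<longleftrightarrow>
     finite P \<and> (\<forall>H. hyperplane H \<longrightarrow> card (P \<inter> H) \<le> DIM('a) + 1)"

definition alpha_set :: "'a::euclidean_space set \<Rightarrow> nat" where
  "alpha_set P = Max {card S |S. S \<subseteq> P \<and> general_position S}"

text \<open>The dimension is passed as a type argument. The infimum is a minimum as soon as there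
  is an admissible set of \<open>n\<close> points (\<open>Inf {} = 0\<close> on \<^typ>\<open>nat\<close>); in the plane this is the
  case for every \<open>n\<close>, see \<open>alpha_plane_attained\<close> below.\<close>

definition alpha :: "'a::euclidean_space itself \<Rightarrow> nat \<Rightarrow> nat" where
  "alpha _ n = Inf {alpha_set P |P :: 'a set. card P = n \<and> almost_general_position P}"

text \<open>The number of times the binary logarithm must be applied until the result is at
  most 1. Iterates beyond the first such value never matter.\<close>

definition log_star :: "real \<Rightarrow> nat" where
  "log_star x = (LEAST k. (log 2 ^^ k) x \<le> 1)"

lemma log_star_exists: "\<exists>k. (log 2 ^^ k) x \<le> 1"
proof -
  have "\<exists>k. (log 2 ^^ k) x \<le> 1" if "x \<le> real m + 1" for m x
    using that
  proof (induction m arbitrary: x)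
    case 0
    then show ?case by (intro exI[of _ 0]) simp
  next
    case (Suc m)
    show ?case
    proof (cases "x \<le> 2")
      case True
      have "log 2 x \<le> 1 \<or> x \<le> 1"
        using True by (cases "x > 0") auto
      then have "(log 2 ^^ 1) x \<le> 1 \<or> (log 2 ^^ 0) x \<le> 1" by simp
      then show ?thesis by blast
    next
      case False
      have "ln (x / 2) \<le> x / 2 - 1"
        using False by (intro ln_le_minus_one) auto
      moreover have "ln x = ln (x / 2) + ln 2"
        using False by (simp add: ln_div)
      moreover have "ln 2 \<ge> (1/2::real)"
        using ln_le_minus_one[of "1/2::real"] by (simp add: ln_div)
      moreover have "(x - 2) * (1/2) \<le> (x - 2) * ln (2::real)"
        using False calculation(3) by (intro mult_left_mono) auto
      ultimately have "ln x \<le> (x - 1) * ln 2"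
        by (simp add: field_simps)
      then have "log 2 x \<le> x - 1"
        by (simp add: log_def divide_simps)
      then have "log 2 x \<le> real m + 1" using Suc.prems by simp
      then obtain k where "(log 2 ^^ k) (log 2 x) \<le> 1" using Suc.IH by blast
      then show ?thesis
        by (intro exI[of _ "Suc k"]) (simp add: funpow_Suc_right del: funpow.simps)
    qed
  qed
  moreover obtain m where "x \<le> real m" using real_arch_simple by blast
  ultimately show ?thesis by (metis add_increasing2 zero_le_one)
qed

lemma alpha_set_attained:
  assumes "finite (P :: 'a::euclidean_space set)"
  shows "\<exists>S\<subseteq>P. general_position S \<and> card S = alpha_set P"
proof -
  let ?A = "{card S |S. S \<subseteq> P \<and> general_position S}"
  have "finite ?A"
    using assms by (intro finite_subset[of ?A "card ` Pow P"]) auto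
  moreover have "card ({} :: 'a set) \<in> ?A"
    unfolding general_position_def by fastforce
  ultimately have "Max ?A \<in> ?A" by (intro Max_in) auto
  then show ?thesis unfolding alpha_set_def by auto
qed

lemma plane_almost_general_position_exists:
  "\<exists>P :: (real^2) set. card P = n \<and> almost_general_position P"
proof -
  define f :: "nat \<Rightarrow> real^2" where "f i = vector [real i, (real i)^2]" for i
  have inj: "inj f"
    by (rule injI) (simp add: f_def vec_eq_iff forall_2)
  have "card (f ` {..<n} \<inter> H) \<le> 3" if hyp: "hyperplane H" for H
  proof -
    obtain a b where a: "a \<noteq> 0" and H: "H = {x. a \<bullet> x = b}"
      using hyp unfolding hyperplane_def by blast
    define p where "p = [:- b, a $ 1, a $ 2:]"
    have p0: "p \<noteq> 0"
      using a by (auto simp: p_def vec_eq_iff forall_2)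
    have "f ` {..<n} \<inter> H \<subseteq> (\<lambda>t. vector [t, t^2]) ` {t. poly p t = 0}"
      by (auto simp: H f_def inner_vec_def sum_2 p_def algebra_simps power2_eq_square)
    moreover have fin: "finite {t. poly p t = 0}" by (rule poly_roots_finite[OF p0])
    ultimately have "card (f ` {..<n} \<inter> H) \<le> card {t. poly p t = 0}"
      by (meson card_image_le card_mono finite_imageI le_trans)
    also have "\<dots> \<le> degree p" by (rule card_poly_roots_bound[OF p0])
    also have "\<dots> \<le> 3" by (simp add: p_def)
    finally show ?thesis .
  qed
  then have "almost_general_position (f ` {..<n})"
    by (simp add: almost_general_position_def)
  moreover have "card (f ` {..<n}) = n"
    using inj by (simp add: card_image inj_on_subset)
  ultimately show ?thesis by blast
qed

lemma alpha_plane_attained: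
  "\<exists>P :: (real^2) set. card P = n \<and> almost_general_position P \<and> alpha_set P = alpha TYPE(real^2) n"
proof -
  let ?A = "{alpha_set P |P :: (real^2) set. card P = n \<and> almost_general_position P}"
  have "?A \<noteq> {}" using plane_almost_general_position_exists[of n] by blast
  then have "Inf ?A \<in> ?A" by (rule Inf_nat_def1)
  then show ?thesis unfolding alpha_def by auto
qed

end

(* A random subset of the cube {0,...,N-1}^9, projected generically to the plane, has few collinear
   quadruples; deleting a point from each leaves a set with at most three points on a line.

   In a set B containing a large enough fraction of the cube, and for every direction v in
   {1,...,r}^9, at least half of the points of B are followed by two more points of B in
   direction v, so B spans many collinear triples. Hence sets without collinear triples are rare:
   when such a set is enumerated point by point, all but few steps either choose from a small set
   of idle points, or discard many candidates, or forbid many new pairs, and the last two kinds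
   happen rarely because a potential drops. By this count, a random subset of density K^2 / r^4
   contains no triple-free set of a size of order 1/K times its own. With r a power of K times a
   constant, the point set has size of order K^160, which is far more than log* requires. *)
theory Submission
  imports Defs "HOL-Combinatorics.Multiset_Permutations"
begin

section \<open>Lattice points and directions as coefficient vectors\<close>

text \<open>Vectors of length \<open>d\<close> are encoded as polynomials of degree less than \<open>d\<close>.\<close>

definition grid :: "nat \<Rightarrow> 'a::zero set \<Rightarrow> 'a poly set" where
  "grid d A = {p. (\<forall>i<d. coeff p i \<in> A) \<and> (\<forall>i\<ge>d. coeff p i = 0)}"

lemma grid_0: "grid 0 A = {0}"
  by (auto simp: grid_def poly_eq_iff)

lemma grid_Suc: "grid (Suc d) A = case_prod pCons ` (A \<times> grid d A)"
proof (intro set_eqI iffI)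
  fix p assume p: "p \<in> grid (Suc d) A"
  obtain a q where pq: "p = pCons a q" by (cases p)
  have "coeff p 0 \<in> A" using p by (auto simp: grid_def)
  moreover have "coeff q i \<in> A" if "i < d" for i
    using p that by (auto simp: grid_def pq dest: spec[of _ "Suc i"])
  moreover have "coeff q i = 0" if "i \<ge> d" for i
    using p that by (auto simp: grid_def pq dest: spec[of _ "Suc i"])
  ultimately have "(a, q) \<in> A \<times> grid d A" by (auto simp: grid_def pq)
  then show "p \<in> case_prod pCons ` (A \<times> grid d A)" using pq by force
next
  fix p assume "p \<in> case_prod pCons ` (A \<times> grid d A)"
  then show "p \<in> grid (Suc d) A"
    by (auto simp: grid_def coeff_pCons split: nat.splits)
qed

lemma finite_grid: "finite A \<Longrightarrow> finite (grid d A)"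
  by (induction d) (auto simp: grid_0 grid_Suc)

lemma card_grid: "card (grid d A) = card A ^ d"
proof (induction d)
  case (Suc d)
  have "inj_on (case_prod pCons) (A \<times> grid d A)" by (auto simp: inj_on_def)
  then show ?case by (simp add: grid_Suc card_image card_cartesian_product Suc)
qed (simp add: grid_0)

abbreviation cube :: "nat \<Rightarrow> nat \<Rightarrow> real poly set" where
  "cube d N \<equiv> grid d (real ` {..<N})"

abbreviation directions :: "nat \<Rightarrow> nat \<Rightarrow> real poly set" where
  "directions d r \<equiv> grid d (real ` {1..r})"

lemma card_cube: "card (cube d N) = N ^ d"
  by (simp add: card_grid card_image)

lemma card_directions: "card (directions d r) = r ^ d"
  by (simp add: card_grid card_image)

section \<open>Collinear triples in dense subsets of the cube\<close>

lemma translate_in_cube: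
  assumes "x \<in> cube d N" "v \<in> directions d r" "N = k * r" "i < k"
  shows "x + smult (real i) v \<in> cube d (2 * N)"
proof -
  have "coeff (x + smult (real i) v) j \<in> real ` {..<2 * N}" if "j < d" for j
  proof -
    have "coeff x j \<in> real ` {..<N}" "coeff v j \<in> real ` {1..r}"
      using assms(1,2) that unfolding grid_def by blast+
    then obtain a c where a: "a < N" "coeff x j = real a" and c: "c \<le> r" "coeff v j = real c"
      by (auto simp del: One_nat_def)
    \<comment> \<open>A direction has coordinates at most \<open>r\<close> and is used fewer than
      \<open>k\<close> times, so each coordinate moves by at most \<open>N\<close>; hence the
      doubled cube.\<close>
    have "i * c \<le> k * r" using assms c by (intro mult_mono) auto
    then have "a + i * c < 2 * N" using a assms by simp
    moreover have "coeff (x + smult (real i) v) j = real (a + i * c)" using a c by simp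
    ultimately show ?thesis by blast
  qed
  then show ?thesis using assms by (auto simp: grid_def)
qed

text \<open>The translates of the set of last points by \<open>0, v, \<dots>, (k - 1) v\<close> are disjoint.\<close>

lemma card_last_points_le:
  assumes B: "B \<subseteq> cube d N" and v: "v \<in> directions d r" and "0 < d" and N: "N = k * r"
  shows "k * card {x \<in> B. \<forall>i>0. x + smult (real i) v \<notin> B} \<le> 2 ^ d * N ^ d"
proof -
  let ?B = "{x \<in> B. \<forall>i>0. x + smult (real i) v \<notin> B}"
  let ?f = "\<lambda>(i, x). x + smult (real i) v"
  have *: "i \<ge> j" if "x \<in> ?B" "y \<in> ?B" "x + smult (real i) v = y + smult (real j) v" for i j x y
  proof (rule ccontr)
    assume "\<not> i \<ge> j"
    then have "x = y + smult (real (j - i)) v"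
      using that(3) by (simp add: of_nat_diff smult_diff_left algebra_simps)
    moreover have "j - i > 0" using \<open>\<not> i \<ge> j\<close> by simp
    ultimately show False using that(1,2) by blast
  qed
  have "inj_on ?f ({..<k} \<times> ?B)"
  proof (rule inj_onI)
    fix s t assume "s \<in> {..<k} \<times> ?B" "t \<in> {..<k} \<times> ?B" and e: "?f s = ?f t"
    moreover obtain i x j y where st: "s = (i, x)" "t = (j, y)" by (meson surj_pair)
    ultimately have xy: "x \<in> ?B" "y \<in> ?B" "x + smult (real i) v = y + smult (real j) v" by auto
    have "i = j" using *[OF xy] *[OF xy(2,1) xy(3)[symmetric]] by simp
    then show "s = t" using xy(3) st by simp
  qed
  moreover have "?f ` ({..<k} \<times> ?B) \<subseteq> cube d (2 * N)"
    using translate_in_cube[OF _ v N] B by auto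
  ultimately have "card ({..<k} \<times> ?B) \<le> card (cube d (2 * N))"
    by (intro card_inj_on_le) (auto intro: finite_grid)
  then show ?thesis by (simp add: card_cartesian_product card_cube power_mult_distrib)
qed

text \<open>Two layers are peeled off: \<open>B0\<close> holds the points of \<open>B\<close>
  without a successor in direction \<open>v\<close>, \<open>B1\<close> the points of
  \<open>B - B0\<close> without a successor in \<open>B - B0\<close>. Any other point has a
  successor that has a successor itself. Each layer has at most \<open>2 ^ d * N ^ d / k\<close>
  points, a quarter of \<open>B\<close> at most by the size hypothesis.\<close>

lemma card_starts_ge:
  assumes B: "B \<subseteq> cube d N" and v: "v \<in> directions d r" and "0 < d" and N: "N = k * r"
    and big: "4 * 2 ^ d * N ^ d \<le> k * card B" and k: "0 < k"
  shows "card B \<le> 2 * card {x \<in> B. \<exists>i j. 0 < i \<and> i < j \<and>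
    x + smult (real i) v \<in> B \<and> x + smult (real j) v \<in> B}" (is "_ \<le> 2 * card ?S")
proof -
  have fin: "finite B" using B finite_grid finite_subset by blast
  define B0 where "B0 = {x \<in> B. \<forall>i>0. x + smult (real i) v \<notin> B}"
  define B1 where "B1 = {x \<in> B - B0. \<forall>i>0. x + smult (real i) v \<notin> B - B0}"
  have "B \<subseteq> B0 \<union> B1 \<union> ?S"
  proof
    fix x assume x: "x \<in> B"
    show "x \<in> B0 \<union> B1 \<union> ?S"
    proof (cases "x \<in> B0 \<union> B1")
      case False
      then obtain i where i: "i > 0" "x + smult (real i) v \<in> B - B0"
        using x by (auto simp: B1_def)
      then obtain j where j: "j > 0" "x + smult (real i) v + smult (real j) v \<in> B"
        by (auto simp: B0_def)
      then have "x + smult (real (i + j)) v \<in> B" by (simp add: smult_add_left add.assoc)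
      moreover have "i < i + j" using j by simp
      ultimately have "x \<in> ?S" using x i by blast
      then show ?thesis by blast
    qed auto
  qed
  then have "card B \<le> card (B0 \<union> B1 \<union> ?S)"
    using fin by (intro card_mono) (auto simp: B0_def B1_def)
  also have "\<dots> \<le> card B0 + card B1 + card ?S"
    by (meson add_le_mono1 card_Un_le le_trans)
  finally have "k * card B \<le> k * (card B0 + card B1 + card ?S)"
    by (rule mult_le_mono2)
  then have "k * card B \<le> k * card B0 + k * card B1 + k * card ?S"
    by (simp only: distrib_left)
  moreover have "k * card B0 \<le> 2 ^ d * N ^ d"
    unfolding B0_def by (rule card_last_points_le) fact+
  moreover have "k * card B1 \<le> 2 ^ d * N ^ d"
    unfolding B1_def using B by (intro card_last_points_le[OF _ v \<open>0 < d\<close> N]) auto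
  ultimately have "k * card B \<le> k * (2 * card ?S)" using big by linarith
  then show ?thesis using k by simp
qed

text \<open>In each of the \<open>r ^ d\<close> directions at least half of \<open>B\<close> starts
  a triple. Directions that yield the same triple are proportional, and the first coordinate, which
  takes \<open>r\<close> nonzero values, tells them apart. So only a factor \<open>r\<close> is
  lost, whence the exponent \<open>d - 1\<close>.\<close>

lemma supersaturation:
  assumes B: "B \<subseteq> cube d N" and "0 < d" and N: "N = k * r"
    and big: "4 * 2 ^ d * N ^ d \<le> k * card B" and k: "0 < k"
  shows "r ^ (d - 1) * card B \<le> 2 * card {(x, y, z) \<in> B \<times> B \<times> B. \<exists>v\<in>directions d r.
    \<exists>i j. 0 < i \<and> i < j \<and> y = x + smult (real i) v \<and> z = x + smult (real j) v}"
    (is "_ \<le> 2 * card ?T")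
proof (cases "r = 0")
  case True
  then have "B \<subseteq> {}" using B \<open>0 < d\<close> N by (auto simp: grid_def)
  then show ?thesis by simp
next
  case False
  have fin: "finite B" using B finite_grid finite_subset by blast
  define P where "P v x i j \<longleftrightarrow> 0 < i \<and> i < j \<and> x + smult (real i) v \<in> B \<and>
    x + smult (real j) v \<in> B" for v x and i j :: nat
  define S where "S v = {x \<in> B. \<exists>i j. P v x i j}" for v
  have "\<exists>g. \<forall>v x. x \<in> S v \<longrightarrow> P v x (fst (g v x)) (snd (g v x))"
    unfolding S_def by (intro choice allI) (auto simp: split_paired_Ex)
  then obtain g where g: "\<And>v x. x \<in> S v \<Longrightarrow> P v x (fst (g v x)) (snd (g v x))" by blast
  define f where "f = (\<lambda>(v, x). (x, x + smult (real (fst (g v x))) v, x + smult (real (snd (g v x))) v))"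
  define h where "h = (\<lambda>(v, x). (coeff v 0, f (v, x)))"
  let ?D = "directions d r"
  have "inj_on h (Sigma ?D S)"
  proof (rule inj_onI)
    fix s t assume s: "s \<in> Sigma ?D S" and t: "t \<in> Sigma ?D S" and e: "h s = h t"
    obtain v x w y where st: "s = (v, x)" "t = (w, y)" by (meson surj_pair)
    define i j where "i = fst (g v x)" "j = fst (g w y)"
    have [simp]: "y = x" and c: "coeff v 0 = coeff w 0" and *: "smult (real i) v = smult (real j) w"
      using e by (auto simp: st h_def f_def i_j_def)
    have "coeff v 0 \<in> real ` {1..r}" using s \<open>0 < d\<close> by (simp add: st grid_def)
    then have "coeff v 0 \<noteq> 0" by auto
    moreover have "real i * coeff v 0 = real j * coeff w 0" using * by (metis coeff_smult)
    ultimately have "i = j" using c by simp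
    moreover have "i > 0" using g s by (auto simp: st P_def i_j_def)
    ultimately have "v = w" using * by (metis of_nat_0_less_iff order_less_irrefl smult_eq_iff)
    then show "s = t" by (simp add: st)
  qed
  moreover have "h ` Sigma ?D S \<subseteq> real ` {1..r} \<times> ?T"
  proof
    fix t assume "t \<in> h ` Sigma ?D S"
    then obtain v x where v: "v \<in> ?D" and x: "x \<in> S v" and t: "t = h (v, x)" by auto
    have "coeff v 0 \<in> real ` {1..r}" using v \<open>0 < d\<close> by (simp add: grid_def)
    moreover have "f (v, x) \<in> ?T"
      using g[OF x] v x unfolding f_def P_def S_def by auto
    ultimately show "t \<in> real ` {1..r} \<times> ?T" by (simp add: t h_def)
  qed
  moreover have "finite ?T" by (rule finite_subset[of _ "B \<times> B \<times> B"]) (use fin in auto)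
  ultimately have "card (Sigma ?D S) \<le> card (real ` {1..r} \<times> ?T)"
    by (intro card_inj_on_le) auto
  also have "\<dots> = r * card ?T" by (simp add: card_cartesian_product card_image)
  finally have 1: "card (Sigma ?D S) \<le> r * card ?T" .
  have "card B \<le> 2 * card (S v)" if "v \<in> ?D" for v
    using card_starts_ge[OF B that \<open>0 < d\<close> N big k] by (simp add: S_def P_def)
  then have "(\<Sum>v\<in>?D. card B) \<le> (\<Sum>v\<in>?D. 2 * card (S v))" by (intro sum_mono) auto
  also have "\<dots> = 2 * card (Sigma ?D S)"
    using fin by (subst card_SigmaI) (auto intro: finite_grid simp: S_def sum_distrib_left)
  finally have "r ^ d * card B \<le> 2 * card (Sigma ?D S)"
    by (simp only: sum_constant card_directions of_nat_id)
  with 1 have "r ^ d * card B \<le> r * (2 * card ?T)" by linarith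
  moreover have "r ^ d = r * r ^ (d - 1)" using \<open>0 < d\<close> by (simp add: power_eq_if)
  ultimately show ?thesis using False by (simp add: mult.assoc)
qed

section \<open>Counting triple-free sets by enumerating them point by point\<close>

text \<open>\<open>G\<close> collects the pairs that must not both occur in the list, \<open>A\<close> the elements that may
  still be used.\<close>

fun avoids :: "('a \<Rightarrow> 'a \<Rightarrow> 'a \<Rightarrow> bool) \<Rightarrow> 'a set \<Rightarrow> ('a \<times> 'a) set \<Rightarrow> 'a list \<Rightarrow> bool" where
  "avoids T A G [] \<longleftrightarrow> True"
| "avoids T A G (x # xs) \<longleftrightarrow>
     x \<in> A \<and> avoids T (A - {y. (x, y) \<in> G}) (G \<union> {(y, z). T x y z}) xs"

text \<open>Allows the counting to carry out only part of an update: restoring candidates or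
  forgetting forbidden pairs admits more lists. Only elements of \<open>A\<close> can occur in the
  list, so \<open>G'\<close> matters on \<open>A \<times> A\<close> alone.\<close>

lemma avoids_mono: "avoids T A G xs \<Longrightarrow> A \<subseteq> A' \<Longrightarrow> G' \<inter> A \<times> A \<subseteq> G \<Longrightarrow> avoids T A' G' xs"
proof (induction xs arbitrary: A G A' G')
  case (Cons x xs)
  let ?A = "A - {y. (x, y) \<in> G}" and ?A' = "A' - {y. (x, y) \<in> G'}"
  have "x \<in> A" using Cons.prems by simp
  then have "?A \<subseteq> ?A'" using Cons.prems(2,3) by auto
  moreover have "(G' \<union> {(y, z). T x y z}) \<inter> ?A \<times> ?A \<subseteq> G \<union> {(y, z). T x y z}"
    using Cons.prems(3) by auto
  ultimately have "avoids T ?A' (G' \<union> {(y, z). T x y z}) xs"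
    using Cons.IH[of ?A "G \<union> {(y, z). T x y z}"] Cons.prems(1) by simp
  then show ?case using Cons.prems(2) \<open>x \<in> A\<close> by auto
qed simp

lemma avoids_set_subset: "avoids T A G xs \<Longrightarrow> set xs \<subseteq> A"
  by (induction xs arbitrary: A G) auto

lemma avoids_if_free:
  assumes "S \<subseteq> A" "G \<inter> S \<times> S = {}" "\<And>x y z. x \<in> S \<Longrightarrow> y \<in> S \<Longrightarrow> z \<in> S \<Longrightarrow> \<not> T x y z" "set xs \<subseteq> S"
  shows "avoids T A G xs"
  using assms
proof (induction xs arbitrary: A G)
  case (Cons x xs)
  have "avoids T (A - {y. (x, y) \<in> G}) (G \<union> {(y, z). T x y z}) xs"
    using Cons.prems by (intro Cons.IH) auto
  then show ?case using Cons.prems by auto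
qed simp

text \<open>\<open>D\<close> is the degree in \<open>G\<close> from which choosing a point counts as
  discarding many candidates, \<open>E\<close> the number of new pairs that counts as many,
  \<open>L\<close> bounds the codegrees, and supersaturation starts at size \<open>b\<close>. The
  surplus \<open>D * L\<close> in it pays for triples that contain a pair already in
  \<open>G\<close>.\<close>

locale triple_system =
  fixes V :: "'a set" and T :: "'a \<Rightarrow> 'a \<Rightarrow> 'a \<Rightarrow> bool" and D L E b :: nat
  assumes finite_V: "finite V"
    and T_swap12: "T x y z \<Longrightarrow> T y x z" and T_swap23: "T x y z \<Longrightarrow> T x z y"
    and codegree: "x \<in> V \<Longrightarrow> y \<in> V \<Longrightarrow> card {z \<in> V. T x y z} \<le> L"
    and supersaturated: "B \<subseteq> V \<Longrightarrow> b \<le> card B \<Longrightarrow>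
      (E + D * L) * card B \<le> card {(x, y, z) \<in> B \<times> B \<times> B. T x y z}"
    and D_pos: "0 < D" and E_pos: "0 < E" and b_pos: "0 < b" and b_le: "b \<le> card V"
begin

definition nbrs :: "'a set \<Rightarrow> ('a \<times> 'a) set \<Rightarrow> 'a \<Rightarrow> 'a set" where
  "nbrs A G x = {y \<in> A. (x, y) \<in> G}"

text \<open>Pairs with an end of degree \<open>D\<close> or more are left out. A degree therefore
  grows only from below \<open>D\<close>, and by at most \<open>L\<close> in one step, which keeps
  it within the bound \<open>D + L\<close> of \<open>admissible\<close>.\<close>

definition new_pairs :: "'a set \<Rightarrow> ('a \<times> 'a) set \<Rightarrow> 'a \<Rightarrow> ('a \<times> 'a) set" where
  "new_pairs A G x = {(y, z) \<in> A \<times> A. T x y z \<and> (y, z) \<notin> G \<and>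
     card (nbrs A G y) < D \<and> card (nbrs A G z) < D}"

definition idle :: "'a set \<Rightarrow> ('a \<times> 'a) set \<Rightarrow> 'a set" where
  "idle A G = {x \<in> A. card (nbrs A G x) < D \<and> card (new_pairs A G x) < E}"

definition admissible :: "'a set \<Rightarrow> ('a \<times> 'a) set \<Rightarrow> bool" where
  "admissible A G \<longleftrightarrow> A \<subseteq> V \<and> sym G \<and> (\<forall>x\<in>A. card (nbrs A G x) \<le> D + L)"

text \<open>An upper bound for the number of non-idle steps to come. Discarding \<open>y\<close> deletes up to
  \<open>2 * (D + L)\<close> ordered pairs from \<open>G\<close>, which the middle term compensates.\<close>

definition potential :: "'a set \<Rightarrow> ('a \<times> 'a) set \<Rightarrow> real" where
  "potential A G = card A / D + (2 * real (D + L) * card A - real (card (G \<inter> A \<times> A))) / E"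

lemma finite_sub: "A \<subseteq> V \<Longrightarrow> finite A"
  using finite_V finite_subset by blast

lemma finite_new_pairs: "A \<subseteq> V \<Longrightarrow> finite (new_pairs A G x)"
  by (rule finite_subset[of _ "A \<times> A"]) (auto simp: new_pairs_def finite_sub)

text \<open>Double counting of the triples \<open>(x, y, z)\<close> inside a set of \<open>b\<close>
  or more idle points. Either \<open>(y, z)\<close> is in \<open>G\<close>, which happens at most
  \<open>D * L\<close> times per \<open>y\<close> (fewer than \<open>D\<close> neighbours
  \<open>z\<close>, then at most \<open>L\<close> points \<open>x\<close>), or it is a new pair for
  \<open>x\<close>, fewer than \<open>E\<close> times per \<open>x\<close>. Together this is less
  than supersaturation requires.\<close>

lemma card_idle_less:
  assumes A: "A \<subseteq> V"
  shows "card (idle A G) < b"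
proof (rule ccontr)
  let ?B = "idle A G"
  assume "\<not> card ?B < b"
  then have big: "b \<le> card ?B" by simp
  have BA: "?B \<subseteq> A" by (auto simp: idle_def)
  have finA: "finite A" and fin: "finite ?B" using finite_sub A BA by blast+
  let ?U = "{(x, y, z) \<in> ?B \<times> ?B \<times> ?B. T x y z}"
  let ?P = "SIGMA y:?B. SIGMA z:nbrs A G y. {x \<in> V. T y z x}"
  let ?Q = "SIGMA x:?B. new_pairs A G x"
  have finP: "finite ?P"
    using fin finA finite_V by (intro finite_SigmaI) (auto simp: nbrs_def)
  have finQ: "finite ?Q" using fin finite_new_pairs[OF A] by (intro finite_SigmaI) auto
  have "?U \<subseteq> (\<lambda>(y, z, x). (x, y, z)) ` ?P \<union> ?Q"
  proof
    fix t assume "t \<in> ?U"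
    then obtain x y z where t: "t = (x, y, z)" and xyz: "x \<in> ?B" "y \<in> ?B" "z \<in> ?B" "T x y z"
      by auto
    show "t \<in> (\<lambda>(y, z, x). (x, y, z)) ` ?P \<union> ?Q"
    proof (cases "t \<in> ?Q")
      case False
      then have "(y, z) \<in> G" using xyz by (auto simp: t idle_def new_pairs_def)
      moreover have "T y z x" using xyz(4) T_swap12 T_swap23 by blast
      ultimately have "(y, z, x) \<in> ?P" using xyz BA A by (auto simp: nbrs_def)
      then have "t \<in> (\<lambda>(y, z, x). (x, y, z)) ` ?P" by (force simp: t)
      then show ?thesis ..
    qed simp
  qed
  then have "card ?U \<le> card ((\<lambda>(y, z, x). (x, y, z)) ` ?P \<union> ?Q)"
    using finP finQ by (intro card_mono) auto
  also have "\<dots> \<le> card ((\<lambda>(y, z, x). (x, y, z)) ` ?P) + card ?Q" by (rule card_Un_le)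
  also have "\<dots> \<le> card ?P + card ?Q" using card_image_le[OF finP] by simp
  finally have U: "card ?U \<le> card ?P + card ?Q" .
  have "card ?P = (\<Sum>y\<in>?B. \<Sum>z\<in>nbrs A G y. card {x \<in> V. T y z x})"
    using fin finA finite_V by (subst card_SigmaI; (subst card_SigmaI)?) (auto simp: nbrs_def)
  also have "\<dots> \<le> (\<Sum>y\<in>?B. \<Sum>z\<in>nbrs A G y. L)"
    using BA A by (intro sum_mono codegree) (auto simp: nbrs_def)
  also have "\<dots> \<le> (\<Sum>y\<in>?B. D * L)"
    by (intro sum_mono) (auto simp: idle_def)
  finally have P: "card ?P \<le> card ?B * (D * L)" by simp
  have "card ?Q = (\<Sum>x\<in>?B. card (new_pairs A G x))"
    using fin finite_new_pairs[OF A] by (intro card_SigmaI) auto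
  also have "\<dots> < (\<Sum>x\<in>?B. E)"
  proof (rule sum_strict_mono[OF fin])
    show "?B \<noteq> {}" using big b_pos by auto
  qed (auto simp: idle_def)
  finally have Q: "card ?Q < card ?B * E" by simp
  have "(E + D * L) * card ?B \<le> card ?U"
    using supersaturated[OF _ big] BA A by blast
  then show False using U P Q by (simp add: algebra_simps)
qed

lemma edges_le:
  assumes "admissible A G"
  shows "card (G \<inter> A \<times> A) \<le> card A * (D + L)"
proof -
  have fin: "finite A" using assms finite_sub by (auto simp: admissible_def)
  have "G \<inter> A \<times> A = (SIGMA x:A. nbrs A G x)" by (auto simp: nbrs_def)
  then have "card (G \<inter> A \<times> A) = (\<Sum>x\<in>A. card (nbrs A G x))"
    using fin by (simp add: nbrs_def)
  also have "\<dots> \<le> card A * (D + L)"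
    using assms sum_bounded_above[of A "\<lambda>x. card (nbrs A G x)" "D + L"]
    by (auto simp: admissible_def)
  finally show ?thesis .
qed

lemma potential_nonneg:
  assumes "admissible A G"
  shows "0 \<le> potential A G"
proof -
  have "real (card (G \<inter> A \<times> A)) \<le> real (card A * (D + L))"
    using edges_le[OF assms] by (simp only: of_nat_le_iff)
  also have "\<dots> \<le> 2 * (D + L) * card A" by (simp add: algebra_simps)
  finally show ?thesis unfolding potential_def by simp
qed

text \<open>At least \<open>D\<close> candidates disappear, so \<open>card A / D\<close> falls by at
  least 1. The other term of the potential does not grow, because every lost pair meets the
  discarded set \<open>R\<close>, whose points have degree at most \<open>D + L\<close>.\<close>

lemma discard_neighbours:
  assumes adm: "admissible A G" and x: "x \<in> A" and D: "D \<le> card (nbrs A G x)"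
  defines "A' \<equiv> A - {y. (x, y) \<in> G}"
  shows "admissible A' G" "potential A' G \<le> potential A G - 1"
proof -
  have fin: "finite A" and A: "A \<subseteq> V" and "sym G" and deg: "\<And>y. y \<in> A \<Longrightarrow> card (nbrs A G y) \<le> D + L"
    using adm finite_sub by (auto simp: admissible_def)
  have sub: "A' \<subseteq> A" by (auto simp: A'_def)
  have "card (nbrs A' G y) \<le> card (nbrs A G y)" for y
    using sub fin by (intro card_mono) (auto simp: nbrs_def)
  then show "admissible A' G"
    using sub A deg \<open>sym G\<close> unfolding admissible_def by (meson le_trans subset_iff)
  define R where "R = nbrs A G x"
  have R: "R \<subseteq> A" "A' = A - R" by (auto simp: R_def nbrs_def A'_def)
  have finR: "finite R" using R fin finite_subset by blast
  let ?S = "SIGMA y:R. nbrs A G y"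
  have finS: "finite ?S" using finR fin by (auto simp: nbrs_def)
  \<comment> \<open>\<open>G\<close> consists of ordered pairs: \<open>?S\<close> covers those whose
    first entry is discarded, its swap those whose second entry is.\<close>
  have "G \<inter> A \<times> A \<subseteq> (G \<inter> A' \<times> A') \<union> (?S \<union> prod.swap ` ?S)"
  proof (rule subrelI)
    fix y z assume yz: "(y, z) \<in> G \<inter> A \<times> A"
    then have zy: "(z, y) \<in> G" using \<open>sym G\<close> by (meson IntD1 symD)
    consider "y \<in> R" | "z \<in> R" | "y \<in> A'" "z \<in> A'" using yz R by blast
    then show "(y, z) \<in> (G \<inter> A' \<times> A') \<union> (?S \<union> prod.swap ` ?S)"
    proof cases
      case 2
      then have "(z, y) \<in> ?S" using yz zy by (auto simp: nbrs_def)
      then show ?thesis by force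
    qed (use yz in \<open>auto simp: nbrs_def\<close>)
  qed
  then have "card (G \<inter> A \<times> A) \<le> card ((G \<inter> A' \<times> A') \<union> (?S \<union> prod.swap ` ?S))"
    using finS fin sub by (intro card_mono) (auto intro: finite_subset)
  also have "\<dots> \<le> card (G \<inter> A' \<times> A') + card (?S \<union> prod.swap ` ?S)" by (rule card_Un_le)
  also have "card (?S \<union> prod.swap ` ?S) \<le> card ?S + card (prod.swap ` ?S)" by (rule card_Un_le)
  also have "card (prod.swap ` ?S) \<le> card ?S" by (rule card_image_le[OF finS])
  also have "card ?S = (\<Sum>y\<in>R. card (nbrs A G y))"
    using finR fin by (intro card_SigmaI) (auto simp: nbrs_def)
  also have "\<dots> \<le> card R * (D + L)"
    using deg R sum_bounded_above[of R "\<lambda>y. card (nbrs A G y)" "D + L"] by auto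
  finally have "card (G \<inter> A \<times> A) \<le> card (G \<inter> A' \<times> A') + 2 * (card R * (D + L))" by simp
  then have edges: "real (card (G \<inter> A \<times> A)) \<le> card (G \<inter> A' \<times> A') + 2 * (real (card R) * (real D + real L))"
    by (metis (mono_tags, lifting) of_nat_add of_nat_le_iff of_nat_mult of_nat_numeral)
  have cA: "card A = card A' + card R"
    using R fin finR by (simp add: card_Diff_subset card_mono)
  have "1 \<le> card R / D" using D D_pos by (simp add: R_def)
  moreover have "(2 * real (D + L) * card A' - real (card (G \<inter> A' \<times> A'))) / E
      \<le> (2 * real (D + L) * card A - real (card (G \<inter> A \<times> A))) / E"
    using edges by (intro divide_right_mono) (auto simp: cA algebra_simps)
  moreover have "card A / D = card A' / D + card R / D" by (simp add: cA add_divide_distrib)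
  ultimately show "potential A' G \<le> potential A G - 1" unfolding potential_def by linarith
qed

text \<open>The candidates stay the same while at least \<open>E\<close> ordered pairs join
  \<open>G\<close>, so the second term of the potential falls by at least 1. Only points of degree
  below \<open>D\<close> gain neighbours, and the codegree bound limits the gain to
  \<open>L\<close>.\<close>

lemma add_new_pairs:
  assumes adm: "admissible A G" and x: "x \<in> A" and E: "E \<le> card (new_pairs A G x)"
  defines "G' \<equiv> G \<union> new_pairs A G x"
  shows "admissible A G'" "potential A G' \<le> potential A G - 1"
proof -
  have fin: "finite A" and A: "A \<subseteq> V" and "sym G" and deg: "\<And>y. y \<in> A \<Longrightarrow> card (nbrs A G y) \<le> D + L"
    using adm finite_sub by (auto simp: admissible_def)
  have "sym (new_pairs A G x)"
    using \<open>sym G\<close> T_swap23 unfolding sym_def new_pairs_def by blast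
  then have "sym G'" using \<open>sym G\<close> by (simp add: G'_def sym_Un)
  moreover have "card (nbrs A G' y) \<le> D + L" if y: "y \<in> A" for y
  proof (cases "card (nbrs A G y) < D")
    case True
    have "nbrs A G' y \<subseteq> nbrs A G y \<union> {z \<in> V. T x y z}"
      using A by (auto simp: nbrs_def G'_def new_pairs_def)
    then have "card (nbrs A G' y) \<le> card (nbrs A G y \<union> {z \<in> V. T x y z})"
      using fin finite_V by (intro card_mono) (auto simp: nbrs_def)
    also have "\<dots> \<le> card (nbrs A G y) + card {z \<in> V. T x y z}" by (rule card_Un_le)
    also have "\<dots> \<le> D + L" using True codegree[of x y] x y A by (intro add_mono) auto
    finally show ?thesis .
  next
    case False
    then have "nbrs A G' y = nbrs A G y" by (auto simp: nbrs_def G'_def new_pairs_def)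
    then show ?thesis using deg[OF y] by simp
  qed
  ultimately show "admissible A G'" using A by (simp add: admissible_def)
  have "G' \<inter> A \<times> A = (G \<inter> A \<times> A) \<union> new_pairs A G x"
    by (auto simp: G'_def new_pairs_def)
  moreover have "(G \<inter> A \<times> A) \<inter> new_pairs A G x = {}" by (auto simp: new_pairs_def)
  ultimately have "card (G' \<inter> A \<times> A) = card (G \<inter> A \<times> A) + card (new_pairs A G x)"
    using fin finite_new_pairs[OF A] by (simp add: card_Un_disjoint)
  then have c: "real (card (G \<inter> A \<times> A)) + E \<le> card (G' \<inter> A \<times> A)" using E by simp
  have "potential A G' \<le> card A / D + (2 * real (D + L) * card A - (real (card (G \<inter> A \<times> A)) + E)) / E"
    unfolding potential_def using c by (intro add_left_mono divide_right_mono) auto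
  also have "\<dots> = potential A G - 1" using E_pos by (simp add: potential_def diff_divide_distrib add_divide_distrib)
  finally show "potential A G' \<le> potential A G - 1" .
qed

lemma finite_avoiding_lists:
  assumes "A \<subseteq> V"
  shows "finite {xs. length xs = s \<and> avoids T A G xs}"
proof (rule finite_subset)
  show "{xs. length xs = s \<and> avoids T A G xs} \<subseteq> {xs. set xs \<subseteq> V \<and> length xs = s}"
    using assms avoids_set_subset by blast
qed (rule finite_lists_length_eq[OF finite_V])

text \<open>Induction on the length, splitting by the first element. Fewer than \<open>b\<close>
  choices are idle. There may be up to \<open>card V\<close> others, but each lowers the potential
  by 1 and so saves a factor \<open>card V / b\<close>. Both kinds contribute at most
  \<open>b\<close> times the inductive bound, which gives the factor \<open>2 * b\<close> per
  step.\<close>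

lemma card_avoiding_lists_le:
  assumes "admissible A G"
  shows "card {xs. length xs = s \<and> avoids T A G xs} \<le> (card V / b) powr potential A G * (2 * b) ^ s"
  using assms
proof (induction s arbitrary: A G)
  case 0
  have "{xs. length xs = 0 \<and> avoids T A G xs} = {[]}" by auto
  moreover have "1 \<le> real (card V) / b" using b_le b_pos by simp
  ultimately show ?case using potential_nonneg[OF 0] by (simp add: ge_one_powr_ge_zero)
next
  case (Suc s)
  define q where "q = card V / real b"
  define Z where "Z = q powr potential A G * (2 * b) ^ s"
  have A: "A \<subseteq> V" using Suc.prems by (simp add: admissible_def)
  have q: "1 \<le> q" using b_le b_pos by (simp add: q_def)
  have Z: "0 \<le> Z" using q by (simp add: Z_def)
  have fin: "finite A" using finite_sub A by simp
  define F where "F x = {xs. length xs = s \<and>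
    avoids T (A - {y. (x, y) \<in> G}) (G \<union> {(y, z). T x y z}) xs}" for x
  have less: "card {xs. length xs = s \<and> avoids T A' G' xs} \<le> Z / q"
    if "admissible A' G'" "potential A' G' \<le> potential A G - 1" for A' G'
  proof -
    have "card {xs. length xs = s \<and> avoids T A' G' xs} \<le> q powr potential A' G' * (2 * b) ^ s"
      using Suc.IH[OF that(1)] by (simp add: q_def)
    also have "\<dots> \<le> q powr (potential A G - 1) * (2 * b) ^ s"
      using that(2) q by (intro mult_right_mono powr_mono) auto
    also have "\<dots> = Z / q" using q by (simp add: Z_def powr_diff)
    finally show ?thesis .
  qed
  have le: "card (F x) \<le> card {xs. length xs = s \<and> avoids T A' G' xs}"
    if "A' \<subseteq> V" "A - {y. (x, y) \<in> G} \<subseteq> A'"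
      "G' \<inter> A \<times> A \<subseteq> G \<union> {(y, z). T x y z}" for x A' G'
    unfolding F_def using finite_avoiding_lists[OF that(1)] avoids_mono that(2,3)
    by (intro card_mono subsetI) (auto elim!: avoids_mono)
  \<comment> \<open>Here the effect of choosing \<open>x\<close> is forgotten altogether: the lists
    are counted from the unchanged state \<open>A\<close>, \<open>G\<close>.\<close>
  have idle: "card (F x) \<le> Z" for x
  proof -
    have "card (F x) \<le> card {xs. length xs = s \<and> avoids T A G xs}" using le[OF A] by auto
    then have "real (card (F x)) \<le> card {xs. length xs = s \<and> avoids T A G xs}"
      by (simp only: of_nat_le_iff)
    also have "\<dots> \<le> Z" using Suc.IH[OF Suc.prems] by (simp add: Z_def q_def)
    finally show ?thesis .
  qed
  \<comment> \<open>Only one effect is kept: the discarded candidates if \<open>x\<close> has large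
    degree, otherwise the new pairs.\<close>
  have active: "card (F x) \<le> Z / q" if "x \<in> A - idle A G" for x
  proof (cases "D \<le> card (nbrs A G x)")
    case True
    let ?A = "A - {y. (x, y) \<in> G}"
    have "card (F x) \<le> card {xs. length xs = s \<and> avoids T ?A G xs}"
      using A by (intro le) auto
    then show ?thesis
      using less[OF discard_neighbours[OF Suc.prems _ True]] that by fastforce
  next
    case False
    then have "E \<le> card (new_pairs A G x)" using that by (auto simp: idle_def)
    moreover have "card (F x) \<le> card {xs. length xs = s \<and> avoids T A (G \<union> new_pairs A G x) xs}"
      using A by (intro le) (auto simp: new_pairs_def)
    ultimately show ?thesis
      using less[OF add_new_pairs[OF Suc.prems]] that by fastforce
  qed
  have "{xs. length xs = Suc s \<and> avoids T A G xs} = (\<lambda>(x, xs). x # xs) ` (SIGMA x:A. F x)"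
  proof (intro set_eqI iffI)
    fix xs assume "xs \<in> {xs. length xs = Suc s \<and> avoids T A G xs}"
    then show "xs \<in> (\<lambda>(x, xs). x # xs) ` (SIGMA x:A. F x)" by (cases xs) (auto simp: F_def)
  qed (auto simp: F_def)
  moreover have finF: "finite (F x)" for x unfolding F_def using A by (intro finite_avoiding_lists) auto
  ultimately have "card {xs. length xs = Suc s \<and> avoids T A G xs} \<le> card (SIGMA x:A. F x)"
    using fin by (simp only: card_image_le finite_SigmaI)
  also have "card (SIGMA x:A. F x) = (\<Sum>x\<in>A. card (F x))"
    using fin finF by simp
  finally have "real (card {xs. length xs = Suc s \<and> avoids T A G xs}) \<le> (\<Sum>x\<in>A. real (card (F x)))"
    by (metis of_nat_le_iff of_nat_sum)
  also have "\<dots> = (\<Sum>x\<in>idle A G. real (card (F x))) + (\<Sum>x\<in>A - idle A G. real (card (F x)))"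
    using fin by (subst sum.subset_diff[of "idle A G"]) (auto simp: idle_def)
  also have "\<dots> \<le> card (idle A G) * Z + card (A - idle A G) * (Z / q)"
    using idle active by (intro add_mono sum_bounded_above) auto
  also have "\<dots> \<le> b * Z + card V * (Z / q)"
    using card_idle_less[OF A, of G] Z q A finite_V
    by (intro add_mono mult_right_mono) (auto intro!: card_mono)
  also have "\<dots> = 2 * b * Z" using b_pos b_le by (simp add: q_def)
  finally show ?case by (simp add: Z_def q_def algebra_simps)
qed

text \<open>Each of the \<open>fact s\<close> orderings of a triple-free set is an avoiding list for
  the initial state \<open>V\<close>, \<open>{}\<close>, and different sets have different
  orderings. The exponent is the initial potential.\<close>

lemma card_free_sets_le:
  "fact s * card {S. S \<subseteq> V \<and> card S = s \<and> (\<forall>x\<in>S. \<forall>y\<in>S. \<forall>z\<in>S. \<not> T x y z)}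
    \<le> (card V / b) powr (card V / D + 2 * (D + L) * card V / E) * (2 * b) ^ s"
proof -
  let ?F = "{S. S \<subseteq> V \<and> card S = s \<and> (\<forall>x\<in>S. \<forall>y\<in>S. \<forall>z\<in>S. \<not> T x y z)}"
  have adm: "admissible V {}" by (auto simp: admissible_def sym_def nbrs_def)
  have finF: "finite ?F" using finite_V by (intro finite_subset[of ?F "Pow V"]) auto
  have fin: "finite S" if "S \<in> ?F" for S using that finite_sub by auto
  have "card (\<Union>(permutations_of_set ` ?F)) = (\<Sum>S\<in>?F. card (permutations_of_set S))"
  proof (rule card_UN_disjoint[OF finF])
    show "\<forall>S\<in>?F. \<forall>S'\<in>?F. S \<noteq> S' \<longrightarrow> permutations_of_set S \<inter> permutations_of_set S' = {}"
      by (simp add: permutations_of_set_def disjoint_iff)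
  qed simp
  also have "\<dots> = (\<Sum>S\<in>?F. fact s)"
    using fin by (intro sum.cong) auto
  also have "\<dots> = fact s * card ?F" by simp
  finally have "fact s * card ?F = card (\<Union>(permutations_of_set ` ?F))" ..
  also have "\<dots> \<le> card {xs. length xs = s \<and> avoids T V {} xs}"
  proof (intro card_mono finite_avoiding_lists subsetI)
    fix xs assume "xs \<in> \<Union>(permutations_of_set ` ?F)"
    then obtain S where S: "S \<in> ?F" "set xs = S" "distinct xs"
      by (auto simp: permutations_of_set_def)
    then have "length xs = s" by (metis (mono_tags, lifting) distinct_card mem_Collect_eq)
    moreover have "avoids T V {} xs"
      using S by (intro avoids_if_free[of S]) auto
    ultimately show "xs \<in> {xs. length xs = s \<and> avoids T V {} xs}" by simp
  qed simp
  finally have "real (fact s * card ?F) \<le> card {xs. length xs = s \<and> avoids T V {} xs}"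
    by (simp only: of_nat_le_iff)
  also have "\<dots> \<le> (card V / b) powr potential V {} * (2 * b) ^ s"
    by (rule card_avoiding_lists_le[OF adm])
  also have "potential V {} = card V / D + 2 * (D + L) * card V / E"
    by (simp add: potential_def)
  finally show ?thesis by simp
qed

end

section \<open>Random subsets and the deletion method\<close>

lemma sum_Pow_insert:
  assumes "finite X" "x \<notin> X"
  shows "sum f (Pow (insert x X)) = (\<Sum>S\<in>Pow X. f S + f (insert x S))"
proof -
  have "inj_on (insert x) (Pow X)" using assms by (auto simp: inj_on_def)
  then have "sum f (insert x ` Pow X) = (\<Sum>S\<in>Pow X. f (insert x S))" by (simp add: sum.reindex)
  moreover have "Pow X \<inter> insert x ` Pow X = {}" using assms by auto
  ultimately show ?thesis
    using assms by (simp add: Pow_insert sum.union_disjoint sum.distrib)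
qed

text \<open>The left-hand side is the expectation of the right-hand side when every element enters
  \<open>P\<close> independently with probability \<open>p\<close>. The proof fixes the elements one
  by one by conditional expectation. Including \<open>x\<close> turns the weights \<open>c\<close>
  into \<open>c'\<close>, hence the induction over arbitrary \<open>c\<close>.\<close>

lemma random_subset_exists:
  fixes c :: "'a set \<Rightarrow> real"
  assumes "finite X" "0 \<le> p" "p \<le> 1"
  shows "\<exists>P\<subseteq>X. (\<Sum>S\<in>Pow X. p ^ card S * c S) \<le> (\<Sum>S\<in>Pow P. c S)"
  using assms(1)
proof (induction X arbitrary: c)
  case empty
  then show ?case by simp
next
  case (insert x X)
  define w where "w c = (\<Sum>S\<in>Pow X. p ^ card S * c S)" for c :: "'a set \<Rightarrow> real"
  define c' where "c' S = c S + c (insert x S)" for S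
  have "(\<Sum>S\<in>Pow (insert x X). p ^ card S * c S)
      = (\<Sum>S\<in>Pow X. p ^ card S * c S + p ^ card (insert x S) * c (insert x S))"
    using insert.hyps by (rule sum_Pow_insert)
  also have "\<dots> = (\<Sum>S\<in>Pow X. (1 - p) * (p ^ card S * c S) + p * (p ^ card S * c' S))"
  proof (intro sum.cong refl)
    fix S assume "S \<in> Pow X"
    then have "card (insert x S) = Suc (card S)"
      using insert.hyps by (meson PowD card_insert_disjoint finite_subset subsetD)
    then show "p ^ card S * c S + p ^ card (insert x S) * c (insert x S)
        = (1 - p) * (p ^ card S * c S) + p * (p ^ card S * c' S)"
      by (simp add: c'_def algebra_simps)
  qed
  also have "\<dots> = (1 - p) * w c + p * w c'"
    by (simp add: w_def sum.distrib sum_distrib_left)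
  finally have sum: "(\<Sum>S\<in>Pow (insert x X). p ^ card S * c S) = (1 - p) * w c + p * w c'" .
  show ?case
  proof (cases "w c' \<le> w c")
    case True
    then have "(1 - p) * w c + p * w c' \<le> w c"
      using mult_left_mono[OF True \<open>0 \<le> p\<close>] by (simp add: algebra_simps)
    moreover obtain P where "P \<subseteq> X" "w c \<le> (\<Sum>S\<in>Pow P. c S)"
      using insert.IH[of c] by (auto simp: w_def)
    ultimately show ?thesis using sum by (intro exI[of _ P]) auto
  next
    case False
    then have "(1 - p) * w c + p * w c' \<le> w c'"
      using mult_left_mono[of "w c" "w c'" "1 - p"] \<open>p \<le> 1\<close> by (simp add: algebra_simps)
    moreover obtain P where P: "P \<subseteq> X" "w c' \<le> (\<Sum>S\<in>Pow P. c' S)"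
      using insert.IH[of c'] by (auto simp: w_def)
    moreover have "(\<Sum>S\<in>Pow P. c' S) = (\<Sum>S\<in>Pow (insert x P). c S)"
      unfolding c'_def using P insert.hyps
      by (subst sum_Pow_insert) (auto intro: finite_subset)
    ultimately show ?thesis using sum by (intro exI[of _ "insert x P"]) auto
  qed
qed

lemma deletion:
  fixes p :: real
  assumes X: "finite X" and p: "0 \<le> p" "p \<le> 1" and F: "F \<subseteq> Pow X" "{} \<notin> F"
  shows "\<exists>P\<subseteq>X. (\<forall>S\<in>F. \<not> S \<subseteq> P) \<and> p * card X - (\<Sum>S\<in>F. p ^ card S) \<le> card P"
proof -
  \<comment> \<open>With these weights the sum over \<open>Pow P\<close> is \<open>card P\<close>
    minus the number of members of \<open>F\<close> inside \<open>P\<close>.\<close>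
  define c where "c S = (if S \<in> (\<lambda>x. {x}) ` X then 1 else 0) - (if S \<in> F then 1 else (0::real))" for S
  have singles: "(\<Sum>S\<in>Pow P. if S \<in> (\<lambda>x. {x}) ` X then f S else 0) = (\<Sum>x\<in>P. f {x})"
    if "P \<subseteq> X" for P and f :: "'a set \<Rightarrow> real"
  proof -
    have "finite P" using that X finite_subset by blast
    then have "(\<Sum>S\<in>Pow P. if S \<in> (\<lambda>x. {x}) ` X then f S else 0)
        = sum f {S \<in> Pow P. S \<in> (\<lambda>x. {x}) ` X}"
      by (simp only: sum.inter_filter finite_Pow_iff)
    also have "{S \<in> Pow P. S \<in> (\<lambda>x. {x}) ` X} = (\<lambda>x. {x}) ` P" using that by auto
    finally show ?thesis by (simp add: sum.reindex)
  qed
  have members: "(\<Sum>S\<in>Pow P. if S \<in> F then f S else 0) = (\<Sum>S\<in>F \<inter> Pow P. f S)"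
    if "P \<subseteq> X" for P and f :: "'a set \<Rightarrow> real"
  proof -
    have "finite P" using that X finite_subset by blast
    then show ?thesis by (subst Int_commute) (simp add: sum.inter_restrict)
  qed
  obtain P where P: "P \<subseteq> X" "(\<Sum>S\<in>Pow X. p ^ card S * c S) \<le> (\<Sum>S\<in>Pow P. c S)"
    using random_subset_exists[OF X p] by blast
  have finP: "finite P" using P X finite_subset by blast
  have "(\<Sum>S\<in>Pow X. p ^ card S * c S) =
      (\<Sum>S\<in>Pow X. if S \<in> (\<lambda>x. {x}) ` X then p ^ card S else 0)
      - (\<Sum>S\<in>Pow X. if S \<in> F then p ^ card S else 0)"
    unfolding sum_subtractf[symmetric] by (intro sum.cong) (auto simp: c_def)
  also have "\<dots> = p * card X - (\<Sum>S\<in>F. p ^ card S)"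
    using singles[of X] members[of X] F by (simp add: Int_absorb2)
  finally have 1: "p * card X - (\<Sum>S\<in>F. p ^ card S) \<le> (\<Sum>S\<in>Pow P. c S)" using P by simp
  define F' where "F' = F \<inter> Pow P"
  have finF': "finite F'" using finP by (simp add: F'_def)
  have 2: "(\<Sum>S\<in>Pow P. c S) = card P - real (card F')"
    using singles[OF P(1), of "\<lambda>_. 1"] members[OF P(1), of "\<lambda>_. 1"]
    by (simp add: c_def sum_subtractf F'_def)
  \<comment> \<open>One point of each member of \<open>F\<close> contained in \<open>P\<close> will
    be deleted.\<close>
  define g where "g S = (SOME x. x \<in> S)" for S :: "'a set"
  have g: "g S \<in> S" if "S \<in> F" for S
    using that F by (auto simp: g_def some_in_eq)
  have "card P \<le> card (P - g ` F') + card (g ` F')"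
    by (metis card_Un_le Un_Diff_cancel2 card_mono finP finF' finite_UnI finite_imageI le_trans sup_ge1 finite_Diff)
  also have "\<dots> \<le> card (P - g ` F') + card F'" using card_image_le[OF finF'] by simp
  finally have "card P - real (card F') \<le> card (P - g ` F')" by simp
  moreover have "\<not> S \<subseteq> P - g ` F'" if S: "S \<in> F" for S
  proof
    assume *: "S \<subseteq> P - g ` F'"
    then have "S \<in> F'" using S by (auto simp: F'_def)
    then show False using g[OF S] * by blast
  qed
  ultimately show ?thesis using 1 2 P by (intro exI[of _ "P - g ` F'"]) auto
qed

section \<open>Generic projection to the plane and points on common lines\<close>

definition in_line :: "(real^2) \<Rightarrow> (real^2) \<Rightarrow> (real^2) \<Rightarrow> bool" where
  "in_line u v w \<longleftrightarrow> u \<noteq> v \<and> u \<noteq> w \<and> v \<noteq> w \<and> (\<exists>H. hyperplane H \<and> {u, v, w} \<subseteq> H)"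

text \<open>\<open>\<phi>\<close> evaluates a polynomial at two generic points \<open>s\<close> and \<open>t\<close>.\<close>

lemma generic_projection:
  assumes "finite (Y :: real poly set)"
  obtains \<phi> :: "real poly \<Rightarrow> real^2" where
    "\<And>x c y. \<phi> (x + smult c y) = \<phi> x + c *\<^sub>R \<phi> y"
    "inj_on \<phi> Y"
    "\<And>x y z H. x \<in> Y \<Longrightarrow> y \<in> Y \<Longrightarrow> z \<in> Y \<Longrightarrow> x \<noteq> y \<Longrightarrow> hyperplane H \<Longrightarrow> {\<phi> x, \<phi> y, \<phi> z} \<subseteq> H \<Longrightarrow>
       \<exists>c. z = x + smult c (y - x)"
proof -
  define E where "E = (\<lambda>(x, y). x - y) ` (Y \<times> Y)"
  have fin: "finite E" using assms by (simp add: E_def)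
  have avoid: "\<exists>s::real. \<forall>p\<in>Q. p \<noteq> 0 \<longrightarrow> poly p s \<noteq> 0" if "finite Q" for Q
  proof -
    have "finite (\<Union>p\<in>Q - {0}. {s. poly p s = 0})"
      using that by (auto intro: poly_roots_finite)
    then obtain s where "s \<notin> (\<Union>p\<in>Q - {0}. {s::real. poly p s = 0})"
      using ex_new_if_finite[OF infinite_UNIV_char_0] by blast
    then show ?thesis by blast
  qed
  obtain s where s: "\<And>p. p \<in> E \<Longrightarrow> p \<noteq> 0 \<Longrightarrow> poly p s \<noteq> 0" using avoid[OF fin] by blast
  \<comment> \<open>The value of such a polynomial at \<open>t\<close> is the determinant of the
    projections of the differences \<open>p\<close> and \<open>q\<close>. With \<open>t\<close>
    outside the roots, the determinant vanishes only if the polynomial is 0, that is, if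
    \<open>smult (poly p s) q = smult (poly q s) p\<close>.\<close>
  let ?Q = "(\<lambda>(p, q). smult (poly p s) q - smult (poly q s) p) ` (E \<times> E)"
  have "finite ?Q" using fin by simp
  then obtain t where t: "\<And>p. p \<in> ?Q \<Longrightarrow> p \<noteq> 0 \<Longrightarrow> poly p t \<noteq> 0" using avoid by blast
  define \<phi> :: "real poly \<Rightarrow> real^2" where "\<phi> p = vector [poly p s, poly p t]" for p
  have \<phi>: "\<phi> p $ 1 = poly p s" "\<phi> p $ 2 = poly p t" for p by (simp_all add: \<phi>_def)
  show ?thesis
  proof (rule that[of \<phi>])
    show "\<phi> (x + smult c y) = \<phi> x + c *\<^sub>R \<phi> y" for x c y
      by (simp add: vec_eq_iff forall_2 \<phi>)
    show "inj_on \<phi> Y"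
    proof (rule inj_onI)
      fix x y assume xy: "x \<in> Y" "y \<in> Y" "\<phi> x = \<phi> y"
      then have "x - y \<in> E" by (force simp: E_def)
      moreover have "poly (x - y) s = 0" using \<phi>(1) xy(3) by (metis poly_diff right_minus_eq)
      ultimately show "x = y" using s by fastforce
    qed
    fix x y z H assume x: "x \<in> Y" and y: "y \<in> Y" and z: "z \<in> Y" and ne: "x \<noteq> y"
      and H: "hyperplane H" "{\<phi> x, \<phi> y, \<phi> z} \<subseteq> H"
    obtain a b where a: "a \<noteq> 0" and "H = {p. a \<bullet> p = b}" using H by (auto simp: hyperplane_def)
    then have on: "a $ 1 * poly p s + a $ 2 * poly p t = b" if "p \<in> {x, y, z}" for p
      using that H(2) by (auto simp: inner_vec_def sum_2 \<phi>)
    define p q where "p = y - x" and "q = z - x"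
    have E: "p \<in> E" "q \<in> E" using x y z by (force simp: E_def p_def q_def)+
    have p0: "p \<noteq> 0" using ne by (simp add: p_def)
    have 1: "a $ 1 * poly p s + a $ 2 * poly p t = 0" "a $ 1 * poly q s + a $ 2 * poly q t = 0"
      using on[of x] on[of y] on[of z] by (simp_all add: p_def q_def algebra_simps)
    have "a $ 1 \<noteq> 0 \<or> a $ 2 \<noteq> 0" using a by (auto simp: vec_eq_iff forall_2)
    \<comment> \<open>Both projected differences are orthogonal to the nonzero normal vector
      \<open>a\<close>, so their determinant is 0.\<close>
    then have "poly p s * poly q t - poly q s * poly p t = 0"
    proof
      assume "a $ 1 \<noteq> 0"
      moreover have "a $ 1 * (poly p s * poly q t - poly q s * poly p t) = 0"
        using 1 by algebra
      ultimately show ?thesis by simp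
    next
      assume "a $ 2 \<noteq> 0"
      moreover have "a $ 2 * (poly p s * poly q t - poly q s * poly p t) = 0"
        using 1 by algebra
      ultimately show ?thesis by simp
    qed
    then have "poly (smult (poly p s) q - smult (poly q s) p) t = 0" by simp
    moreover have "smult (poly p s) q - smult (poly q s) p \<in> ?Q" using E by force
    ultimately have "smult (poly p s) q - smult (poly q s) p = 0"
      using t by blast
    then have "smult (inverse (poly p s)) (smult (poly p s) q)
        = smult (inverse (poly p s)) (smult (poly q s) p)" by simp
    then have "q = smult (poly q s / poly p s) p"
      using s[OF E(1) p0] by (simp add: field_simps)
    then have "z = x + smult (poly q s / poly p s) (y - x)"
      by (metis add.commute diff_add_cancel p_def q_def)
    then show "\<exists>c. z = x + smult c (y - x)" by blast
  qed
qed

text \<open>A point of the line is determined by any coordinate in which \<open>x\<close> and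
  \<open>y\<close> differ, and that coordinate has \<open>N\<close> possible values.\<close>

lemma card_cube_line_le:
  assumes x: "x \<in> cube d N" and y: "y \<in> cube d N" and "x \<noteq> y"
  shows "card {z \<in> cube d N. \<exists>c. z = x + smult c (y - x)} \<le> N" (is "card ?Z \<le> N")
proof -
  obtain i where i: "coeff x i \<noteq> coeff y i" using \<open>x \<noteq> y\<close> by (auto simp: poly_eq_iff)
  have "coeff x i = coeff y i" if "d \<le> i" using x y that by (simp add: grid_def)
  then have "i < d" using i by force
  have "inj_on (\<lambda>z. coeff z i) ?Z" using i by (auto simp: inj_on_def)
  moreover have "(\<lambda>z. coeff z i) ` ?Z \<subseteq> real ` {..<N}" using \<open>i < d\<close> by (auto simp: grid_def)
  ultimately have "card ?Z \<le> card (real ` {..<N})" by (intro card_inj_on_le) auto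
  then show ?thesis by (simp add: card_image)
qed

text \<open>Genericity creates no new collinearities, so a line through two points of
  \<open>X\<close> carries no more points than a line in the cube. Linearity preserves the
  progressions in direction \<open>v\<close>, so supersaturation carries over.\<close>

lemma lattice_projection:
  assumes "0 < d" and N: "N = k * r" and k: "0 < k"
  obtains X :: "(real^2) set" where "finite X" "card X = N ^ d"
    "\<And>u v. u \<in> X \<Longrightarrow> v \<in> X \<Longrightarrow> card {w \<in> X. in_line u v w} \<le> N"
    "\<And>B. B \<subseteq> X \<Longrightarrow> 4 * 2 ^ d * N ^ d \<le> k * card B \<Longrightarrow>
       r ^ (d - 1) * card B \<le> 2 * card {(u, v, w) \<in> B \<times> B \<times> B. in_line u v w}"
proof -
  have fin: "finite (cube d N)" by (intro finite_grid) auto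
  obtain \<phi> :: "real poly \<Rightarrow> real^2" where lin: "\<And>x c y. \<phi> (x + smult c y) = \<phi> x + c *\<^sub>R \<phi> y"
    and inj: "inj_on \<phi> (cube d N)"
    and gen: "\<And>x y z H. x \<in> cube d N \<Longrightarrow> y \<in> cube d N \<Longrightarrow> z \<in> cube d N \<Longrightarrow> x \<noteq> y \<Longrightarrow> hyperplane H
      \<Longrightarrow> {\<phi> x, \<phi> y, \<phi> z} \<subseteq> H \<Longrightarrow> \<exists>c. z = x + smult c (y - x)"
    using generic_projection[OF fin] by metis
  show ?thesis
  proof (rule that[of "\<phi> ` cube d N"])
    show "finite (\<phi> ` cube d N)" using fin by simp
    show "card (\<phi> ` cube d N) = N ^ d" using inj by (simp add: card_image card_cube)
  next
    fix u v assume "u \<in> \<phi> ` cube d N" "v \<in> \<phi> ` cube d N"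
    then obtain x y where xy: "x \<in> cube d N" "y \<in> cube d N" and uv: "u = \<phi> x" "v = \<phi> y" by auto
    show "card {w \<in> \<phi> ` cube d N. in_line u v w} \<le> N"
    proof (cases "x = y")
      case True
      then show ?thesis by (simp add: in_line_def uv)
    next
      case False
      let ?Z = "{z \<in> cube d N. \<exists>c. z = x + smult c (y - x)}"
      have "{w \<in> \<phi> ` cube d N. in_line u v w} \<subseteq> \<phi> ` ?Z"
      proof
        fix w assume "w \<in> {w \<in> \<phi> ` cube d N. in_line u v w}"
        then obtain z H where "z \<in> cube d N" "w = \<phi> z" "hyperplane H" "{u, v, w} \<subseteq> H"
          by (auto simp: in_line_def)
        then show "w \<in> \<phi> ` ?Z" using gen[OF xy _ False, of z H] uv by blast
      qed
      then have "card {w \<in> \<phi> ` cube d N. in_line u v w} \<le> card (\<phi> ` ?Z)"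
        using fin by (intro card_mono) auto
      also have "\<dots> \<le> card ?Z" using fin by (intro card_image_le) auto
      also have "\<dots> \<le> N" using card_cube_line_le[OF xy False] .
      finally show ?thesis .
    qed
  next
    fix C assume C: "C \<subseteq> \<phi> ` cube d N" and big: "4 * 2 ^ d * N ^ d \<le> k * card C"
    then obtain B where B: "B \<subseteq> cube d N" "C = \<phi> ` B" by (meson subset_imageE)
    have injB: "inj_on \<phi> B" using inj B inj_on_subset by blast
    have finB: "finite B" using B fin finite_subset by blast
    have cC: "card C = card B" using injB B by (simp add: card_image)
    let ?T = "{(x, y, z) \<in> B \<times> B \<times> B. \<exists>v\<in>directions d r.
      \<exists>i j. 0 < i \<and> i < j \<and> y = x + smult (real i) v \<and> z = x + smult (real j) v}"
    let ?U = "{(u, v, w) \<in> C \<times> C \<times> C. in_line u v w}"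
    let ?f = "\<lambda>(x, y, z). (\<phi> x, \<phi> y, \<phi> z)"
    have "inj_on ?f ?T" using injB by (auto simp: inj_on_def)
    moreover have "?f ` ?T \<subseteq> ?U"
    proof
      fix t assume "t \<in> ?f ` ?T"
      then obtain x y z v i j where xyz: "x \<in> B" "y \<in> B" "z \<in> B" and t: "t = (\<phi> x, \<phi> y, \<phi> z)"
        and v: "v \<in> directions d r" and ij: "0 < i" "i < j"
        and y: "y = x + smult (real i) v" and z: "z = x + smult (real j) v" by auto
      have "coeff v 0 \<in> real ` {1..r}" using v \<open>0 < d\<close> by (simp add: grid_def)
      then have "v \<noteq> 0" by auto
      moreover have "z - y = smult (real j - real i) v" by (simp add: y z smult_diff_left)
      ultimately have "x \<noteq> y" "x \<noteq> z" "y \<noteq> z"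
        using ij by (auto simp: y z)
      then have "\<phi> x \<noteq> \<phi> y" "\<phi> x \<noteq> \<phi> z" "\<phi> y \<noteq> \<phi> z" using injB xyz by (auto simp: inj_on_def)
      \<comment> \<open>The vector \<open>\<phi> v\<close> turned by a right angle is a normal of
        the line through the three images.\<close>
      moreover define a :: "real^2" where "a = vector [- \<phi> v $ 2, \<phi> v $ 1]"
      have "\<phi> v \<noteq> 0" using \<open>\<phi> x \<noteq> \<phi> y\<close> by (auto simp: y lin)
      then have "a \<noteq> 0" by (auto simp: a_def vec_eq_iff forall_2)
      then have "hyperplane {p. a \<bullet> p = a \<bullet> \<phi> x}" by (auto simp: hyperplane_def)
      moreover have "a \<bullet> \<phi> v = 0" by (simp add: a_def inner_vec_def sum_2)
      then have "{\<phi> x, \<phi> y, \<phi> z} \<subseteq> {p. a \<bullet> p = a \<bullet> \<phi> x}" by (auto simp: y z lin inner_add_right)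
      ultimately have "in_line (\<phi> x) (\<phi> y) (\<phi> z)" unfolding in_line_def by blast
      then show "t \<in> ?U" using xyz B(2) t by simp
    qed
    moreover have "finite ?U" by (rule finite_subset[of _ "C \<times> C \<times> C"]) (use finB B in auto)
    ultimately have TU: "card ?T \<le> card ?U" by (rule card_inj_on_le)
    have "r ^ (d - 1) * card C \<le> 2 * card ?T"
      using supersaturation[OF B(1) \<open>0 < d\<close> N _ k] big cC by simp
    also have "\<dots> \<le> 2 * card ?U" using TU by (rule mult_le_mono2)
    finally show "r ^ (d - 1) * card C \<le> 2 * card ?U" .
  qed
qed

text \<open>An ordered pair of points of the quadruple spans its line, and each of the two remaining
  points is among at most \<open>N\<close> points of that line.\<close>

lemma card_collinear_quadruples_le:
  assumes fin: "finite X" and line: "\<And>u v. u \<in> X \<Longrightarrow> v \<in> X \<Longrightarrow> card {w \<in> X. in_line u v w} \<le> N"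
  shows "card {S. S \<subseteq> X \<and> card S = 4 \<and> (\<exists>H. hyperplane H \<and> S \<subseteq> H)} \<le> (card X)\<^sup>2 * N\<^sup>2"
    (is "card ?Q \<le> _")
proof -
  let ?L = "\<lambda>(u, v). {w \<in> X. in_line u v w}"
  let ?P = "SIGMA e:X \<times> X. ?L e \<times> ?L e"
  have finP: "finite ?P" using fin by (intro finite_SigmaI) auto
  have "?Q \<subseteq> (\<lambda>((u, v), (w, x)). {u, v, w, x}) ` ?P"
  proof
    fix S assume "S \<in> ?Q"
    then obtain H where S: "S \<subseteq> X" "card S = 4" and H: "hyperplane H" "S \<subseteq> H" by auto
    from S(2) obtain u v w x where e: "S = {u, v, w, x}"
      and "u \<noteq> v" "u \<noteq> w" "v \<noteq> w" "u \<noteq> x" "v \<noteq> x"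
      by (auto simp: card_Suc_eq eval_nat_numeral)
    then have "in_line u v w" "in_line u v x" using H by (auto simp: in_line_def)
    then have "((u, v), (w, x)) \<in> ?P" using e S(1) by auto
    then show "S \<in> (\<lambda>((u, v), (w, x)). {u, v, w, x}) ` ?P" using e by force
  qed
  then have "card ?Q \<le> card ?P" using finP by (rule surj_card_le[rotated])
  also have "card ?P = (\<Sum>e\<in>X \<times> X. card (?L e) * card (?L e))"
    using fin by (subst card_SigmaI) (auto simp: card_cartesian_product)
  also have "\<dots> \<le> (\<Sum>e\<in>X \<times> X. N * N)"
    using line by (intro sum_mono mult_le_mono) auto
  finally show ?thesis by (simp add: card_cartesian_product power2_eq_square)
qed

section \<open>Choice of the parameters and the planar point set\<close>

lemma power_over_fact_le_exp:
  assumes "0 \<le> (x::real)"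
  shows "x ^ s / fact s \<le> exp x"
proof -
  have "x ^ s / fact s = (\<Sum>n\<in>{s}. x ^ n /\<^sub>R fact n)" by (simp add: divide_inverse)
  also have "\<dots> \<le> (\<Sum>n. x ^ n /\<^sub>R fact n)"
    using assms by (intro sum_le_suminf summable_exp_generic) auto
  finally show ?thesis by (simp add: exp_def)
qed

text \<open>With \<open>f\<close> the number of triple-free \<open>s\<close>-sets,
  \<open>p ^ s * f\<close> is the expected number of them in a random subset of density
  \<open>p\<close>. Since \<open>p * b = m\<close>, it is at most \<open>2 powr (34 * K * m)\<close>
  from the potential, times \<open>(4 * m) ^ s / fact s\<close>, which is at most
  \<open>2 powr (8 * m)\<close>, divided by \<open>2 ^ s\<close>. The choice
  \<open>s = 48 * K * m\<close> outweighs both exponents.\<close>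

lemma container_estimate:
  fixes m K s :: nat and f W b p :: real
  assumes K: "1 \<le> K" and f: "fact s * f \<le> (real K ^ 2) powr W * (2 * b) ^ s"
    and W: "W \<le> 17 * m" and s: "s = 48 * K * m" and pb: "p * b = m" and p: "0 \<le> p"
  shows "p ^ s * f \<le> 1"
proof -
  have "p ^ s * f \<le> p ^ s * ((real K ^ 2) powr W * (2 * b) ^ s / fact s)"
    using f p by (intro mult_left_mono) (auto simp: field_simps)
  also have "\<dots> = (real K ^ 2) powr W * ((4 * (p * b)) ^ s / fact s) / 2 ^ s"
  proof -
    have "(4 * (p * b)) ^ s = p ^ s * (2 * b) ^ s * 2 ^ s"
      unfolding power_mult_distrib[symmetric] by (simp add: ac_simps)
    then show ?thesis by simp
  qed
  also have "\<dots> \<le> (2 powr (34 * K * m)) * (2 powr (8 * m)) / 2 ^ s"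
  proof (intro divide_right_mono mult_mono)
    have "real K \<le> 2 ^ K" using less_exp[of K] by (metis less_imp_le of_nat_le_iff of_nat_numeral of_nat_power)
    then have "real K ^ 2 \<le> (2 ^ K)\<^sup>2" by (intro power_mono) auto
    also have "\<dots> = 2 ^ (2 * K)" by (simp add: mult.commute flip: power_mult)
    also have "\<dots> = 2 powr real (2 * K)" by (rule powr_realpow[symmetric]) simp
    finally have K2: "real K ^ 2 \<le> 2 powr (2 * K)" .
    have "(real K ^ 2) powr W \<le> (real K ^ 2) powr (17 * m)"
      using K W by (intro powr_mono) auto
    also have "\<dots> \<le> (2 powr (2 * K)) powr (17 * m)"
      using K2 by (intro powr_mono2) auto
    also have "\<dots> = 2 powr (34 * K * m)" by (simp add: powr_powr mult.assoc)
    finally show "(real K ^ 2) powr W \<le> 2 powr (34 * K * m)" by simp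
    have "(4 * (p * b)) ^ s / fact s \<le> exp (4 * m)"
      using power_over_fact_le_exp[of "4 * (p * b)" s] by (simp add: pb)
    also have "\<dots> = exp 1 ^ (4 * m)" by (simp flip: exp_of_nat_mult)
    also have "\<dots> \<le> 4 ^ (4 * m)" using exp_le by (intro power_mono) auto
    also have "\<dots> = (2 ^ 2) ^ (4 * m)" by simp
    also have "\<dots> = 2 ^ (8 * m)" by (simp only: flip: power_mult) simp
    also have "\<dots> = 2 powr real (8 * m)" by (rule powr_realpow[symmetric]) simp
    finally show "(4 * (p * b)) ^ s / fact s \<le> 2 powr (8 * m)" .
  qed (use p pb in auto)
  also have "\<dots> = 2 powr (real (34 * K * m) + real (8 * m) - real s)"
    by (simp only: powr_add powr_diff powr_realpow zero_less_numeral)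
  also have "\<dots> \<le> 2 powr 0"
  proof (rule powr_mono)
    have "34 * K * m + 8 * m \<le> s" using mult_le_mono1[OF K, of m] unfolding s by linarith
    then have "real (34 * K * m + 8 * m) \<le> s" by (simp only: of_nat_le_iff)
    then show "real (34 * K * m) + real (8 * m) - real s \<le> 0" by simp
  qed simp
  finally show ?thesis by simp
qed


text \<open>Deletion is applied to \<open>Free\<close> and \<open>Quad\<close> together, so one set
  \<open>P\<close> contains neither four collinear points nor a triple-free set of size
  \<open>s\<close>. On average, members of \<open>Free\<close> cost at most one point and members of
  \<open>Quad\<close> a quarter of the points, which leaves at least half of
  \<open>K ^ 2 * m\<close>.\<close>

lemma sparse_point_set:
  assumes K: "1 \<le> K"
  obtains P :: "(real^2) set" where "almost_general_position P" "2 ^ 713 * K ^ 160 \<le> card P"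
    "\<And>S. S \<subseteq> P \<Longrightarrow> general_position S \<Longrightarrow> card S < 48 * 2 ^ 714 * K ^ 159"
proof -
  \<comment> \<open>With \<open>p = K\<^sup>2 / r ^ 4\<close>, the choice of \<open>r\<close> makes \<open>p\<^sup>3 * N ^ 11 = 1 / 4\<close>, so that a quarter of
    the expected number \<open>p * N ^ 9 = K\<^sup>2 * m\<close> of points suffices to destroy all quadruples.\<close>
  define q where "q = 2 ^ 121 * K ^ 28"
  define r where "r = 4 * q"
  \<comment> \<open>This makes the supersaturation threshold \<open>4 * 2 ^ 9 * N ^ 9 / k\<close>
    equal to \<open>b = N ^ 9 / K ^ 2\<close>.\<close>
  define k where "k = 2 ^ 11 * K ^ 2"
  define N where "N = k * r"
  define m where "m = 2 ^ 99 * K ^ 18 * r ^ 5"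
  define b where "b = 2 ^ 99 * K ^ 16 * r ^ 9"
  define s where "s = 48 * K * m"
  define p where "p = real K ^ 2 / real r ^ 4"
  have q: "1 \<le> q" and r: "1 \<le> r" and k: "0 < k" and m: "1 \<le> m" and b: "0 < b"
    using K by (auto simp: q_def r_def k_def m_def b_def)
  have rK: "2 ^ 13 * K ^ 2 \<le> r"
    unfolding r_def q_def using K by (intro order_trans[OF mult_mono[of "2 ^ 13" "2 ^ 123" "K ^ 2" "K ^ 28"]])
      (auto intro: power_increasing)
  have N9: "N ^ 9 = 2 ^ 99 * K ^ 18 * r ^ 9"
    by (simp add: N_def k_def power_mult_distrib flip: power_mult)
  have m_eq: "real (N ^ 9) = m * real r ^ 4" by (simp add: N9 m_def flip: power_add)
  have b_eq: "N ^ 9 = K ^ 2 * b" by (simp add: N9 b_def flip: power_add)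
  have m_val: "K ^ 2 * m = 2 ^ 714 * K ^ 160"
    by (simp add: m_def r_def q_def power_mult_distrib flip: power_mult power_add)
  have "r \<le> r ^ 3" using r by (auto intro: self_le_power)
  with rK have r3: "2 ^ 13 * K ^ 2 \<le> r ^ 3" by linarith
  have "r ^ 3 * r = r ^ 4" using power_Suc2[of r 3] by simp
  with mult_le_mono1[OF r3, of r] have Nr: "4 * N \<le> r ^ 4" by (simp add: N_def k_def)
  have r44: "r ^ 4 * r ^ 4 = r ^ 8" by (simp flip: power_add)
  have "4 * (r ^ 7 * q) = r ^ 7 * r" by (simp add: r_def)
  also have "\<dots> = r ^ 8" using power_Suc2[of r 7] by simp
  finally have r8: "4 * (r ^ 7 * q) = r ^ 8" .
  obtain X :: "(real^2) set" where X: "finite X" "card X = N ^ 9"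
    and line: "\<And>u v. u \<in> X \<Longrightarrow> v \<in> X \<Longrightarrow> card {w \<in> X. in_line u v w} \<le> N"
    and sat: "\<And>B. B \<subseteq> X \<Longrightarrow> 4 * 2 ^ 9 * N ^ 9 \<le> k * card B \<Longrightarrow>
       r ^ (9 - 1) * card B \<le> 2 * card {(u, v, w) \<in> B \<times> B \<times> B. in_line u v w}"
    using lattice_projection[of 9 N k r] N_def k by auto
  \<comment> \<open>Supersaturation yields \<open>r ^ 8 / 2\<close> triples per point. One half of
    this is \<open>E = r ^ 7 * q = r ^ 8 / 4\<close>, the other covers
    \<open>D * L = r ^ 4 * N\<close> because \<open>4 * N \<le> r ^ 4\<close>.\<close>
  interpret triple_system X in_line "r ^ 4" N "r ^ 7 * q" b
  proof
    fix B assume B: "B \<subseteq> X" "b \<le> card B"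
    have "4 * 2 ^ 9 * N ^ 9 = k * b" by (simp add: b_eq k_def)
    then have "4 * 2 ^ 9 * N ^ 9 \<le> k * card B" using B(2) by simp
    then have *: "r ^ 8 * card B \<le> 2 * card {(u, v, w) \<in> B \<times> B \<times> B. in_line u v w}"
      using sat[OF B(1)] by simp
    have "2 * (r ^ 7 * q + r ^ 4 * N) \<le> r ^ 8"
    proof -
      have "4 * (r ^ 4 * N) \<le> r ^ 4 * r ^ 4" using mult_le_mono2[OF Nr, of "r ^ 4"] by simp
      then have "4 * (r ^ 4 * N) \<le> r ^ 8" unfolding r44 .
      then show ?thesis using r8 unfolding distrib_left by linarith
    qed
    from mult_le_mono1[OF this, of "card B"] *
    show "(r ^ 7 * q + r ^ 4 * N) * card B \<le> card {(x, y, z) \<in> B \<times> B \<times> B. in_line x y z}"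
      by linarith
  next
    show "b \<le> card X" using K by (simp add: X b_eq)
    show "in_line y x z" if "in_line x y z" for x y z using that by (auto simp: in_line_def)
    show "in_line x z y" if "in_line x y z" for x y z using that by (auto simp: in_line_def)
  qed (use X line r q b in auto)
  define Free where "Free = {S. S \<subseteq> X \<and> card S = s \<and> (\<forall>x\<in>S. \<forall>y\<in>S. \<forall>z\<in>S. \<not> in_line x y z)}"
  define Quad where "Quad = {S. S \<subseteq> X \<and> card S = 4 \<and> (\<exists>H. hyperplane H \<and> S \<subseteq> H)}"
  have p: "0 < p" "p \<le> 1"
  proof -
    show "0 < p" using K r by (simp add: p_def)
    have "K ^ 2 \<le> 2 ^ 13 * K ^ 2" by simp
    also note rK
    also have "r \<le> r ^ 4" using r by (intro self_le_power) auto
    finally have "real (K ^ 2) \<le> real (r ^ 4)" by (simp only: of_nat_le_iff)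
    then show "p \<le> 1" using r by (simp add: p_def divide_le_eq)
  qed
  have free: "p ^ s * card Free \<le> 1"
  proof -
    let ?W = "card X / real (r ^ 4) + 2 * (r ^ 4 + N) * card X / real (r ^ 7 * q)"
    have "card X / real b = real K ^ 2" using b by (simp add: X b_eq)
    then have 1: "fact s * real (card Free) \<le> (real K ^ 2) powr ?W * (2 * real b) ^ s"
      using card_free_sets_le[of s] by (simp add: Free_def)
    define R where "R = real r ^ 4"
    have "real (4 * N) \<le> real (r ^ 4)" using Nr by (simp only: of_nat_le_iff)
    then have "4 * real N \<le> real r ^ 4" by simp
    then have R: "real N \<le> R" "0 < R" unfolding R_def using r by (linarith, simp)
    have E: "real (r ^ 7 * q) = R * R / 4"
      using arg_cong[OF r8[folded r44], of real] by (simp add: R_def)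
    have M: "real (card X) = m * R" using m_eq by (simp add: X R_def)
    \<comment> \<open>The first summand equals \<open>m\<close>; the second is at most
      \<open>16 * m\<close>, as \<open>N \<le> R\<close>.\<close>
    have "?W = real (card X) / R + 2 * (R + N) * real (card X) / real (r ^ 7 * q)"
      by (simp add: R_def)
    also have "\<dots> = m + 8 * ((R + N) / R) * m"
      using R(2) unfolding E M by (simp add: field_simps)
    also have "\<dots> \<le> real m + 8 * 2 * real m"
      using R by (intro add_mono mult_right_mono mult_left_mono) (auto simp: field_simps)
    finally have 2: "?W \<le> 17 * m" by simp
    have 3: "p * b = m" using r by (simp add: p_def m_def b_def field_simps flip: power_add)
    show ?thesis using container_estimate[OF K 1 2 s_def 3] p by simp
  qed
  have quad: "p ^ 4 * card Quad \<le> p * card X / 4"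
  proof -
    have "real (card Quad) \<le> (card X)\<^sup>2 * N\<^sup>2"
      using card_collinear_quadruples_le[OF X(1) line] by (simp only: of_nat_le_iff Quad_def)
    then have "p ^ 4 * card Quad \<le> p ^ 4 * ((card X)\<^sup>2 * N\<^sup>2)" using p by (intro mult_left_mono) auto
    also have "\<dots> = p * card X * (p ^ 3 * real N ^ 11)"
    proof -
      have "((real N ^ 9)\<^sup>2 * (real N)\<^sup>2) = real N ^ 9 * real N ^ 11" by (simp flip: power_mult power_add)
      moreover have "p ^ 4 = p * p ^ 3" using power_Suc[of p 3] by simp
      ultimately show ?thesis by (simp add: X)
    qed
    also have "p ^ 3 * real N ^ 11 = 1 / 4"
    proof -
      \<comment> \<open>Here \<open>N ^ 11 = 2 ^ 121 * K ^ 22 * r ^ 11\<close>, so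
        \<open>K ^ 6 * N ^ 11 = q * r ^ 11\<close>, and \<open>4 * q = r\<close>.\<close>
      have "4 * (real K ^ 6 * real N ^ 11) = real r ^ 12"
        by (simp add: N_def k_def r_def q_def power_mult_distrib flip: power_mult power_add)
      then show ?thesis using r by (simp add: p_def field_simps flip: power_mult)
    qed
    finally show ?thesis by simp
  qed
  have pX: "p * card X = real (K ^ 2 * m)" using r m_eq by (simp add: p_def X)
  \<comment> \<open>Lets the single point lost to \<open>Free\<close> be absorbed in another quarter
    of the expected size.\<close>
  have "4 \<le> K ^ 2 * m" using K by (simp add: m_val)
  then have Km: "4 \<le> real (K ^ 2 * m)" by linarith
  have "{} \<notin> Free \<union> Quad" using m K by (auto simp: Free_def Quad_def s_def)
  moreover have "Free \<union> Quad \<subseteq> Pow X" by (auto simp: Free_def Quad_def)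
  ultimately obtain P where P: "P \<subseteq> X" "\<And>S. S \<in> Free \<union> Quad \<Longrightarrow> \<not> S \<subseteq> P"
    and cP: "p * card X - (\<Sum>S\<in>Free \<union> Quad. p ^ card S) \<le> card P"
    using deletion[OF X(1), of p "Free \<union> Quad"] p by auto
  have fin: "finite Free" "finite Quad"
    using X(1) by (auto intro: finite_subset[of _ "Pow X"] simp: Free_def Quad_def)
  have "(\<Sum>S\<in>Free \<union> Quad. p ^ card S) \<le> (\<Sum>S\<in>Free. p ^ card S) + (\<Sum>S\<in>Quad. p ^ card S)"
    using fin p sum_nonneg[of "Free \<inter> Quad" "\<lambda>S. p ^ card S"] by (simp add: sum_Un)
  also have "(\<Sum>S\<in>Free. p ^ card S) = p ^ s * card Free" by (simp add: Free_def)
  also have "(\<Sum>S\<in>Quad. p ^ card S) = p ^ 4 * card Quad" by (simp add: Quad_def)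
  finally have "real (K ^ 2 * m) \<le> real (2 * card P)" using cP free quad Km unfolding pX by linarith
  then have card: "2 ^ 714 * K ^ 160 \<le> 2 * card P" unfolding m_val of_nat_le_iff .
  have finP: "finite P" using P(1) X(1) finite_subset by blast
  have "card (P \<inter> H) \<le> 3" if "hyperplane H" for H
  proof (rule ccontr)
    assume "\<not> card (P \<inter> H) \<le> 3"
    then have "4 \<le> card (P \<inter> H)" by simp
    then obtain S where "S \<subseteq> P \<inter> H" "card S = 4" by (rule obtain_subset_with_card_n)
    then have "S \<in> Quad" "S \<subseteq> P" using that P(1) by (auto simp: Quad_def)
    then show False using P(2) by blast
  qed
  then have "almost_general_position P" using finP by (simp add: almost_general_position_def)
  moreover have "card S < 48 * 2 ^ 714 * K ^ 159" if S: "S \<subseteq> P" "general_position S" for S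
  proof (rule ccontr)
    assume *: "\<not> card S < 48 * 2 ^ 714 * K ^ 159"
    have "K * (K * m) = K * (2 ^ 714 * K ^ 159)"
      using m_val by (simp add: power2_eq_square ac_simps flip: power_Suc)
    then have "K * m = 2 ^ 714 * K ^ 159" using K by simp
    then have "s = 48 * 2 ^ 714 * K ^ 159" by (simp only: s_def mult.assoc)
    then have "s \<le> card S" using * by linarith
    then obtain S' where S': "S' \<subseteq> S" "card S' = s" by (meson obtain_subset_with_card_n)
    have "\<not> in_line x y z" if xyz: "x \<in> S'" "y \<in> S'" "z \<in> S'" for x y z
    proof
      assume "in_line x y z"
      then obtain H where H: "hyperplane H" "{x, y, z} \<subseteq> H" and ne: "x \<noteq> y" "x \<noteq> z" "y \<noteq> z"
        by (auto simp: in_line_def)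
      have "card {x, y, z} \<le> card (S \<inter> H)"
        using H xyz S' S(1) finP by (intro card_mono) (auto intro: finite_subset)
      moreover have "card (S \<inter> H) \<le> 2" using S(2) H(1) by (simp add: general_position_def)
      ultimately show False using ne by simp
    qed
    then have "S' \<in> Free" using S' S P(1) by (auto simp: Free_def)
    then show False using P(2) S' S by blast
  qed
  moreover have "2 ^ 713 * K ^ 160 \<le> card P" using card by simp
  ultimately show ?thesis by (intro that)
qed

text \<open>Any \<open>n\<close> points of the sparse set will do, since having at most three points
  on a line and the bound on subsets in general position both pass to subsets.\<close>

lemma alpha_le:
  assumes K: "1 \<le> K" and n: "n \<le> 2 ^ 713 * K ^ 160"
  shows "alpha TYPE(real^2) n \<le> 48 * 2 ^ 714 * K ^ 159"
proof -
  obtain P :: "(real^2) set" where P: "almost_general_position P" "2 ^ 713 * K ^ 160 \<le> card P"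
    "\<And>S. S \<subseteq> P \<Longrightarrow> general_position S \<Longrightarrow> card S < 48 * 2 ^ 714 * K ^ 159"
    using sparse_point_set[OF K] by blast
  obtain Q where Q: "Q \<subseteq> P" "card Q = n" "finite Q"
    using n P(2) by (meson le_trans obtain_subset_with_card_n)
  have finP: "finite P" using P(1) by (simp add: almost_general_position_def)
  have "card (Q \<inter> H) \<le> card (P \<inter> H)" for H using Q finP by (intro card_mono) auto
  then have "almost_general_position Q"
    using P(1) Q(3) unfolding almost_general_position_def by (meson le_trans)
  then have "alpha TYPE(real^2) n \<le> alpha_set Q"
    unfolding alpha_def using Q(2) by (intro wellorder_Inf_le1) blast
  moreover obtain S where S: "S \<subseteq> Q" "general_position S" "card S = alpha_set Q"
    using alpha_set_attained[OF Q(3)] by blast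
  moreover have "card S < 48 * 2 ^ 714 * K ^ 159" using P(3) S Q(1) by blast
  ultimately show ?thesis by linarith
qed

section \<open>The iterated logarithm and the final bound\<close>

lemma log_star_iterate_le_1: "(log 2 ^^ log_star x) x \<le> 1"
  unfolding log_star_def using log_star_exists by (rule LeastI_ex)

lemma log_star_le_Suc: "log_star x \<le> Suc (log_star (log 2 x))"
  using log_star_iterate_le_1[of "log 2 x"] unfolding log_star_def[of x]
  by (intro Least_le) (simp add: funpow_Suc_right del: funpow.simps)

text \<open>Above 2 one logarithm lowers the argument by at least 1. This linear bound is very weak
  for an iterated logarithm but suffices, because the construction saves a power of
  \<open>n\<close>.\<close>

lemma log_star_le_of_le:
  "x \<le> real m + 1 \<Longrightarrow> log_star x \<le> m"
proof (induction m arbitrary: x)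
  case 0
  then show ?case unfolding log_star_def by (intro Least_le) simp
next
  case (Suc m)
  show ?case
  proof (cases "x \<le> 2")
    case True
    show ?thesis
    proof (cases "x \<le> 1")
      case True
      then have "log_star x \<le> 0" unfolding log_star_def by (intro Least_le) simp
      then show ?thesis by simp
    next
      case False
      then have "log_star x \<le> 1" using True unfolding log_star_def by (intro Least_le) simp
      then show ?thesis by simp
    qed
  next
    case False
    have "ln (x / 2) \<le> x / 2 - 1" using False by (intro ln_le_minus_one) auto
    moreover have "ln x = ln (x / 2) + ln 2" using False by (simp add: ln_div)
    moreover have half: "ln 2 \<ge> (1/2::real)"
      using ln_le_minus_one[of "1/2::real"] by (simp add: ln_div)
    moreover have "(x - 2) * (1/2) \<le> (x - 2) * ln (2::real)"
      using False half by (intro mult_left_mono) auto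
    ultimately have "ln x \<le> (x - 1) * ln 2" by (simp add: field_simps)
    then have "log 2 x \<le> x - 1" by (simp add: log_def divide_simps)
    then have "log 2 x \<le> real m + 1" using Suc.prems by simp
    then have "log_star (log 2 x) \<le> m" by (rule Suc.IH)
    then show ?thesis using log_star_le_Suc[of x] by linarith
  qed
qed

lemma log_star_le_exponent:
  assumes "n \<le> 2 ^ j"
  shows "log_star (real n) \<le> j + 1"
proof (cases "n = 0")
  case True
  then show ?thesis using log_star_le_of_le[of 0 0] by simp
next
  case False
  have "real n \<le> 2 ^ j" using assms by (metis of_nat_le_iff of_nat_numeral of_nat_power)
  then have "log 2 (real n) \<le> log 2 (2 ^ j)" using False by (subst log_le_cancel_iff) auto
  then have "log 2 (real n) \<le> real j + 1" by simp
  then have "log_star (log 2 (real n)) \<le> j" by (rule log_star_le_of_le)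
  then show ?thesis using log_star_le_Suc[of "real n"] by linarith
qed

text \<open>\<open>K\<close> is taken least. It is at least 2 because \<open>n\<close> exceeds
  \<open>2 ^ 713\<close>, hence \<open>K \<le> 2 * (K - 1)\<close>, and failure of the bound at
  \<open>K - 1\<close> costs only the factor \<open>2 ^ 160\<close>.\<close>

lemma scale_exists:
  fixes n :: nat
  assumes n: "2 ^ 713 < n"
  obtains K :: nat where "2 \<le> K" "n \<le> 2 ^ 713 * K ^ 160" "2 ^ 713 * K ^ 160 \<le> 2 ^ 160 * n"
proof -
  define K where "K = (LEAST K. n \<le> 2 ^ 713 * K ^ 160)"
  have "n \<le> n ^ 160" using n by (intro self_le_power) auto
  also have "\<dots> \<le> 2 ^ 713 * n ^ 160" by simp
  finally have K: "n \<le> 2 ^ 713 * K ^ 160" unfolding K_def by (rule LeastI)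
  have "K \<noteq> 0" "K \<noteq> 1" using K n by (auto intro: ccontr)
  then have K2: "2 \<le> K" by linarith
  then have "\<not> n \<le> 2 ^ 713 * (K - 1) ^ 160"
    unfolding K_def by (intro not_less_Least) (auto simp: K_def[symmetric])
  then have "2 ^ 713 * (K - 1) ^ 160 \<le> n" by (simp only: not_le less_imp_le)
  then have "2 ^ 160 * (2 ^ 713 * (K - 1) ^ 160) \<le> 2 ^ 160 * n" by (rule mult_le_mono2)
  moreover have "K ^ 160 \<le> (2 * (K - 1)) ^ 160" using K2 by (intro power_mono) auto
  then have "2 ^ 713 * K ^ 160 \<le> 2 ^ 160 * (2 ^ 713 * (K - 1) ^ 160)"
    unfolding power_mult_distrib by simp
  ultimately have "2 ^ 713 * K ^ 160 \<le> 2 ^ 160 * n" by (rule le_trans[rotated])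
  with K2 K show ?thesis by (rule that)
qed

text \<open>At scale \<open>K\<close> the bound on \<open>alpha\<close> is of order
  \<open>n / K\<close>, while \<open>n\<close> is at most exponential in \<open>K\<close>, so
  \<open>log_star\<close> is at most linear in \<open>K\<close> and its root is at most
  \<open>30 * K\<close>. The constant is \<open>30 * 96 * 2 ^ 160\<close>.\<close>

lemma alpha_le_div_sqrt_log_star:
  assumes n: "2 ^ 713 < n"
  shows "real (alpha TYPE(real^2) n) \<le> 2880 * 2 ^ 160 * real n / sqrt (real (log_star (real n)))"
proof -
  obtain K where K: "2 \<le> K" and nK: "n \<le> 2 ^ 713 * K ^ 160" and Kn: "2 ^ 713 * K ^ 160 \<le> 2 ^ 160 * n"
    using scale_exists[OF n] by blast
  define L where "L = log_star (real n)"
  have "K \<le> 2 ^ K" using less_exp[of K] by simp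
  then have "K ^ 160 \<le> (2 ^ K) ^ 160" by (rule power_mono) simp
  with nK have "n \<le> 2 ^ 713 * (2 ^ K) ^ 160" by (meson le_trans mult_le_mono2)
  also have "\<dots> = 2 ^ (713 + K * 160)" by (simp only: power_add power_mult)
  finally have "L \<le> 714 + K * 160" using log_star_le_exponent[of n "713 + K * 160"] by (simp add: L_def)
  also have "\<dots> \<le> 517 * K" using K by simp
  also have "\<dots> \<le> 900 * (K * K)" using mult_le_mono1[OF K, of K] by linarith
  finally have "real L \<le> real (900 * (K * K))" by (simp only: of_nat_le_iff)
  then have "real L \<le> (30 * real K)\<^sup>2" by (simp add: power2_eq_square)
  then have sqrt: "sqrt (real L) \<le> 30 * real K" by (intro real_le_lsqrt) auto
  \<comment> \<open>Division by zero yields 0, so the root must be positive before multiplying out;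
    \<open>n > 1\<close> ensures this.\<close>
  have "L \<noteq> 0"
  proof
    assume "L = 0"
    then show False using log_star_iterate_le_1[of "real n"] n by (simp add: L_def)
  qed
  have "alpha TYPE(real^2) n \<le> 48 * 2 ^ 714 * K ^ 159" using alpha_le[OF _ nK] K by simp
  then have "alpha TYPE(real^2) n * K \<le> 48 * 2 ^ 714 * K ^ 159 * K" by (rule mult_le_mono1)
  also have "\<dots> = 96 * (2 ^ 713 * K ^ 160)" using power_Suc2[of K 159] by simp
  also have "\<dots> \<le> 96 * (2 ^ 160 * n)" using Kn by (rule mult_le_mono2)
  finally have "real (alpha TYPE(real^2) n * K) \<le> real (96 * (2 ^ 160 * n))" by (simp only: of_nat_le_iff)
  then have a: "real (alpha TYPE(real^2) n) * real K \<le> 96 * 2 ^ 160 * real n" by simp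
  have "real (alpha TYPE(real^2) n) * sqrt (real L) \<le> real (alpha TYPE(real^2) n) * (30 * real K)"
    using sqrt by (rule mult_left_mono) simp
  also have "\<dots> \<le> 2880 * 2 ^ 160 * real n" using a by (simp add: mult.commute)
  finally show ?thesis using \<open>L \<noteq> 0\<close> by (simp add: L_def pos_le_divide_eq)
qed

theorem theorem3:
  shows "\<exists>C>0. \<forall>\<^sub>F n in sequentially.
           real (alpha TYPE(real^2) n) \<le> C * real n / sqrt (real (log_star (real n)))"
proof (intro exI conjI)
  show "\<forall>\<^sub>F n in sequentially. real (alpha TYPE(real^2) n)
      \<le> 2880 * 2 ^ 160 * real n / sqrt (real (log_star (real n)))"
    using eventually_gt_at_top[of "2 ^ 713"] by eventually_elim (rule alpha_le_div_sqrt_log_star)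
qed simp

end
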